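(* Let $\mathcal{A}$ and $\mathcal{B}$ be unital $C^*$-algebras, $\phi:\mathcal{A}\to\mathcal{B}$ a positive unital linear map, $U\subseteq\mathbb{R}^n$ an open convex set and $f:U\to\mathbb{R}$ a convex function. Let $a_1,\dots,a_n\in\mathcal{A}$ be mutually commuting self-adjoint elements with $\prod_{i=1}^n\sigma(a_i)\subseteq U$ and such that $\phi(a_1),\dots,\phi(a_n),\phi(f(a_1,\dots,a_n))$ are also mutually commuting. Then $$f(\phi(a_1),\dots,\phi(a_n))\leq\phi(f(a_1,\dots,a_n)).$$ Moreover, if $\tilde 0=(0,\dots,0)\in U$ and $f(\tilde 0)\leq 0$, then the same inequality holds (under the same commutation hypotheses) even if $\phi$ is only assumed to be positive and contractive instead of positive and unital.
   Context: A linear map between $C^*$-algebras is positive if it maps positive elements to positive elements; it is contractive if its norm is at most $1$. $\sigma(a)$ denotes the spectrum of $a$. A function $f:U\to\mathbb{R}$ on a convex set $U\subseteq\mathbb{R}^n$ is convex if $f(\lambda x+(1-\lambda)y)\leq\lambda f(x)+(1-\lambda)f(y)$ for all $x,y\in U$, $0\leq\lambda\leq1$. Multivariable functional calculus: for mutually commuting self-adjoint elements $a_1,\dots,a_n$ of a unital $C^*$-algebra, the unital $C^*$-algebra $C^*(a_1,\dots,a_n)$ they generate is abelian; its joint spectrum is $\sigma(a_1,\dots,a_n)=\{(\gamma(a_1),\dots,\gamma(a_n)):\gamma \text{ a character of } C^*(a_1,\dots,a_n)\}\subseteq\prod_i\sigma(a_i)$, and $C^*(a_1,\dots,a_n)\cong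 C(\sigma(a_1,\dots,a_n))$ with $a_i$ corresponding to the $i$-th coordinate function. For $f$ continuous on the joint spectrum, $f(a_1,\dots,a_n)$ is the element corresponding to $f$ (restricted to the joint spectrum) under this $^*$-isomorphism. *)

theory Defs
  imports "HOL-Analysis.Analysis"
begin

(* The superclass real_normed_algebra_1 includes norm 1 = 1, so the zero algebra is excluded. *)
class unital_cstar_algebra = real_normed_algebra_1 + banach +
  fixes scaleC :: "complex \<Rightarrow> 'a \<Rightarrow> 'a"  (infixr \<open>*\<^sub>C\<close> 75)
    and adj :: "'a \<Rightarrow> 'a"
  assumes scaleC_add_right: "c *\<^sub>C (x + y) = c *\<^sub>C x + c *\<^sub>C y"
    and scaleC_add_left: "(c + d) *\<^sub>C x = c *\<^sub>C x + d *\<^sub>C x"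
    and scaleC_scaleC: "c *\<^sub>C d *\<^sub>C x = (c * d) *\<^sub>C x"
    and scaleC_of_real: "complex_of_real r *\<^sub>C x = r *\<^sub>R x"
    and mult_scaleC_left: "(c *\<^sub>C x) * y = c *\<^sub>C (x * y)"
    and mult_scaleC_right: "x * (c *\<^sub>C y) = c *\<^sub>C (x * y)"
    and norm_scaleC: "norm (c *\<^sub>C x) = cmod c * norm x"
    and adj_add: "adj (x + y) = adj x + adj y"
    and adj_scaleC: "adj (c *\<^sub>C x) = cnj c *\<^sub>C adj x"
    and adj_mult: "adj (x * y) = adj y * adj x"
    and adj_adj: "adj (adj x) = x"
    and norm_adj_mult_self: "norm (adj x * x) = (norm x)\<^sup>2"

definition spectrum :: "'a::unital_cstar_algebra \<Rightarrow> complex set" where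
  "spectrum x = {c. \<not> (\<exists>y. (x - c *\<^sub>C 1) * y = 1 \<and> y * (x - c *\<^sub>C 1) = 1)}"

definition selfadjoint :: "'a::unital_cstar_algebra \<Rightarrow> bool" where
  "selfadjoint x \<longleftrightarrow> adj x = x"

definition positive_elem :: "'a::unital_cstar_algebra \<Rightarrow> bool" where
  "positive_elem x \<longleftrightarrow> selfadjoint x \<and> spectrum x \<subseteq> complex_of_real ` {0..}"

definition cstar_le :: "'a::unital_cstar_algebra \<Rightarrow> 'a \<Rightarrow> bool"  (infix \<open>\<preceq>\<close> 50) where
  "x \<preceq> y \<longleftrightarrow> positive_elem (y - x)"

definition positive_map :: "('a::unital_cstar_algebra \<Rightarrow> 'b::unital_cstar_algebra) \<Rightarrow> bool" where
  "positive_map \<phi> \<longleftrightarrow> (\<forall>x. positive_elem x \<longrightarrow> positive_elem (\<phi> x))"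

definition contractive :: "('a::unital_cstar_algebra \<Rightarrow> 'b::unital_cstar_algebra) \<Rightarrow> bool" where
  "contractive \<phi> \<longleftrightarrow> (\<forall>x. norm (\<phi> x) \<le> norm x)"

definition unital_cstar_subalgebra :: "'a::unital_cstar_algebra set \<Rightarrow> bool" where
  "unital_cstar_subalgebra S \<longleftrightarrow>
     closed S \<and> 1 \<in> S \<and> (\<forall>x\<in>S. \<forall>y\<in>S. x + y \<in> S \<and> x * y \<in> S) \<and>
     (\<forall>c. \<forall>x\<in>S. c *\<^sub>C x \<in> S) \<and> (\<forall>x\<in>S. adj x \<in> S)"

definition cstar_generated :: "'a::unital_cstar_algebra set \<Rightarrow> 'a set" where
  "cstar_generated G = unital_cstar_subalgebra hull G"

(* Only the values on the subalgebra S matter. *)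
definition character_on :: "'a::unital_cstar_algebra set \<Rightarrow> ('a \<Rightarrow> complex) \<Rightarrow> bool" where
  "character_on S \<gamma> \<longleftrightarrow>
     (\<forall>x\<in>S. \<forall>y\<in>S. \<gamma> (x + y) = \<gamma> x + \<gamma> y \<and> \<gamma> (x * y) = \<gamma> x * \<gamma> y) \<and>
     (\<forall>c. \<forall>x\<in>S. \<gamma> (c *\<^sub>C x) = c * \<gamma> x) \<and> (\<exists>x\<in>S. \<gamma> x \<noteq> 0)"

(* Used for commuting self-adjoint families only. Characters take real values on self-adjoint
   elements, so the joint spectrum is recorded as a subset of real^'n. *)
definition joint_spectrum :: "('n::finite \<Rightarrow> 'a::unital_cstar_algebra) \<Rightarrow> (real^'n) set" where
  "joint_spectrum a =
     {s. \<exists>\<gamma>. character_on (cstar_generated (range a)) \<gamma> \<and> (\<forall>i. \<gamma> (a i) = complex_of_real (s $ i))}"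

(* \<Psi> is a *-isomorphism from the generated algebra onto C(joint_spectrum a) sending a i to the
   i-th coordinate function. Elements of C(K) are represented by functions that are continuous
   on K and undefined outside K, so that equality of functions is equality on K. *)
definition fun_calc_iso ::
    "('n::finite \<Rightarrow> 'a::unital_cstar_algebra) \<Rightarrow> ('a \<Rightarrow> real^'n \<Rightarrow> complex) \<Rightarrow> bool" where
  "fun_calc_iso a \<Psi> \<longleftrightarrow>
     (let A = cstar_generated (range a); K = joint_spectrum a in
        bij_betw \<Psi> A {g \<in> extensional K. continuous_on K g} \<and>
        (\<forall>x\<in>A. \<forall>y\<in>A. \<forall>s\<in>K. \<Psi> (x + y) s = \<Psi> x s + \<Psi> y s \<and> \<Psi> (x * y) s = \<Psi> x s * \<Psi> y s) \<and>
        (\<forall>c. \<forall>x\<in>A. \<forall>s\<in>K. \<Psi> (c *\<^sub>C x) s = c * \<Psi> x s) \<and>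
        (\<forall>x\<in>A. \<forall>s\<in>K. \<Psi> (adj x) s = cnj (\<Psi> x s)) \<and>
        (\<forall>s\<in>K. \<Psi> 1 s = 1) \<and>
        (\<forall>i. \<forall>s\<in>K. \<Psi> (a i) s = complex_of_real (s $ i)))"

definition fun_calc ::
    "(real^'n::finite \<Rightarrow> real) \<Rightarrow> ('n \<Rightarrow> 'a::unital_cstar_algebra) \<Rightarrow> 'a" where
  "fun_calc f a =
     (THE b. b \<in> cstar_generated (range a) \<and>
        (\<exists>\<Psi>. fun_calc_iso a \<Psi> \<and> (\<forall>s\<in>joint_spectrum a. \<Psi> b s = complex_of_real (f s))))"

end

theory Submission
  imports Defs
begin

text \<open>
  Let \<open>b = f(a\<^sub>1, \<dots>, a\<^sub>n)\<close> and let \<open>C\<close> be the C*-algebra generated by the commuting self-adjoint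
  elements \<open>\<phi>(a\<^sub>1), \<dots>, \<phi>(a\<^sub>n), \<phi>(b)\<close>. As \<open>C\<close> is commutative, positivity of
  \<open>\<phi>(b) - f(\<phi>(a\<^sub>1), \<dots>, \<phi>(a\<^sub>n))\<close> may be tested on the characters \<open>\<gamma>\<close> of \<open>C\<close>. Put
  \<open>s\<^sub>i = \<gamma>(\<phi>(a\<^sub>i))\<close>, a point of the joint spectrum of the \<open>\<phi>(a\<^sub>i)\<close>. A supporting affine function
  \<open>c + v \<bullet> x \<le> f(x)\<close> of \<open>f\<close> at \<open>s\<close> yields \<open>b - c - \<Sum>\<^sub>i v\<^sub>i a\<^sub>i \<ge> 0\<close>; applying \<open>\<phi>\<close> and then
  \<open>\<gamma>\<close> gives \<open>\<gamma>(\<phi>(b)) \<ge> c + v \<bullet> s = f(s)\<close>. If \<open>\<phi>\<close> is contractive instead of unital, then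
  \<open>c \<le> f(0) \<le> 0\<close>, and \<open>- c (1 - \<phi>(1))\<close> only helps (\<open>affine_minorant_character\<close>). The same estimate,
  applied to affine functions that separate \<open>s\<close> from the convex hull of the joint spectrum of
  \<open>a\<close> (together with \<open>0\<close> in the contractive case), shows that \<open>s\<close> lies in \<open>U\<close>
  (\<open>joint_spectrum_image_subset\<close>).

  The rest develops the commutative Gelfand theory behind this argument: characters exist and
  compute norms and positivity (\<open>noninvertible_character\<close>, \<open>norm_attained_by_character\<close>,
  \<open>positive_elemI\<close>), and by the Stone--Weierstrass theorem the functional calculus exists and is
  unique (\<open>fun_calc_point_character\<close>). No complex analysis is needed. Apart from Neumann series, characters
  are obtained from the binomial series for \<open>sqrt (1 - y)\<close>, convergent for \<open>norm y \<le> 1\<close>. With the identity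
  \<open>u\<^sup>* u = p\<^sup>2 + q\<^sup>2\<close> for \<open>u = p + i q\<close> it yields \<open>norm (1 - z\<^sup>2) \<le> 1\<close> for self-adjoint \<open>z\<close> in the
  unit ball, with strict inequality if \<open>z\<close> is invertible. The strict form gives spectral permanence
  (\<open>inverse_in\<close>). The series also provides absolute values, hence positive and negative parts, from
  which a real Dedekind cut shows that self-adjoint elements are real scalars modulo a maximal ideal
  (\<open>selfadjoint_scalar_modulo_ideal\<close>).
\<close>

section \<open>Adjoints, complex scalars and self-adjoint elements\<close>

declare scaleC_of_real [simp] adj_adj [simp]

lemma scaleC_one [simp]: "1 *\<^sub>C (x::'a::unital_cstar_algebra) = x"
  using scaleC_of_real[of 1 x] by simp

lemma scaleC_minus_one [simp]: "(- 1) *\<^sub>C (x::'a::unital_cstar_algebra) = - x"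
  using scaleC_of_real[of "- 1" x] by simp

lemma scaleC_zero [simp]: "0 *\<^sub>C (x::'a::unital_cstar_algebra) = 0"
  using scaleC_of_real[of 0 x] by simp

lemma scaleC_minus_right: "c *\<^sub>C (- x) = - (c *\<^sub>C (x::'a::unital_cstar_algebra))"
  by (metis scaleC_minus_one scaleC_scaleC mult.commute)

lemma scaleC_minus_left: "(- c) *\<^sub>C (x::'a::unital_cstar_algebra) = - (c *\<^sub>C x)"
  by (metis scaleC_minus_one scaleC_scaleC mult_minus1)

lemma scaleC_diff_right: "c *\<^sub>C (x - y) = c *\<^sub>C x - c *\<^sub>C (y::'a::unital_cstar_algebra)"
  using scaleC_add_right[of c x "- y"] by (simp add: scaleC_minus_right)

lemma scaleC_diff_left: "(c - d) *\<^sub>C x = c *\<^sub>C x - d *\<^sub>C (x::'a::unital_cstar_algebra)"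
  using scaleC_add_left[of c "- d" x] by (simp add: scaleC_minus_left)

lemma adj_scaleR: "adj (r *\<^sub>R x) = r *\<^sub>R adj (x::'a::unital_cstar_algebra)"
  using adj_scaleC[of "complex_of_real r" x] by simp

lemma adj_zero [simp]: "adj (0::'a::unital_cstar_algebra) = 0"
  using adj_scaleR[of 0 "0::'a"] by simp

lemma adj_minus: "adj (- x) = - adj (x::'a::unital_cstar_algebra)"
  using adj_scaleR[of "- 1" x] by simp

lemma adj_diff: "adj (x - y) = adj x - adj (y::'a::unital_cstar_algebra)"
  using adj_add[of x "- y"] by (simp add: adj_minus)

lemma adj_one [simp]: "adj (1::'a::unital_cstar_algebra) = 1"
  by (metis adj_adj adj_mult mult.right_neutral)

lemma adj_power: "adj (x ^ n) = adj (x::'a::unital_cstar_algebra) ^ n"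
  by (induction n) (simp_all add: adj_mult power_commutes)

lemma norm_adj [simp]: "norm (adj x) = norm (x::'a::unital_cstar_algebra)"
proof -
  have *: "norm z \<le> norm (adj z)" for z :: 'a
  proof (cases "z = 0")
    case False
    have "norm z * norm z \<le> norm (adj z) * norm z"
      using norm_mult_ineq[of "adj z" z] norm_adj_mult_self[of z] by (simp add: power2_eq_square)
    then show ?thesis using False by simp
  qed simp
  show ?thesis using *[of x] *[of "adj x"] by simp
qed

lemma bounded_linear_adj: "bounded_linear (adj :: 'a::unital_cstar_algebra \<Rightarrow> 'a)"
  by (rule bounded_linear_intro[where K = 1]) (simp_all add: adj_add adj_scaleR)

lemmas continuous_on_adj = bounded_linear.continuous_on[OF bounded_linear_adj]

lemma norm_selfadjoint_square:
  "adj x = x \<Longrightarrow> norm (x * x) = (norm (x::'a::unital_cstar_algebra))\<^sup>2"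
  using norm_adj_mult_self[of x] by simp

lemma selfadjoint_inverse:
  fixes x y :: "'a::unital_cstar_algebra"
  assumes "adj x = x" "x * y = 1" "y * x = 1"
  shows "adj y = y"
proof -
  have "adj y * x = 1" using arg_cong[OF assms(2), of adj] assms(1) by (simp add: adj_mult)
  then show ?thesis by (metis assms(2) mult.assoc mult.left_neutral mult.right_neutral)
qed

text \<open>Commuting self-adjoint \<open>p\<close>, \<open>q\<close> are the real and imaginary parts of the normal element
  \<open>u = p + i q\<close>, for which \<open>u\<^sup>* u = p\<^sup>2 + q\<^sup>2\<close>; this replaces monotonicity of the norm on positive
  elements.\<close>

lemma norm_square_le_norm_sum_squares:
  fixes p q :: "'a::unital_cstar_algebra"
  assumes "adj p = p" "adj q = q" "p * q = q * p"
  shows "(norm p)\<^sup>2 \<le> norm (p * p + q * q)"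
proof -
  define u where "u = p + \<i> *\<^sub>C q"
  have adju: "adj u = p - \<i> *\<^sub>C q"
    by (simp add: u_def adj_add adj_scaleC assms scaleC_minus_left)
  have "adj u * u = p * p + q * q"
    unfolding adju by (simp add: u_def algebra_simps mult_scaleC_left mult_scaleC_right
        scaleC_scaleC scaleC_add_right scaleC_diff_right assms(3))
  then have nu: "(norm u)\<^sup>2 = norm (p * p + q * q)"
    using norm_adj_mult_self[of u] by simp
  have "2 *\<^sub>R p = u + adj u"
    unfolding adju by (simp add: u_def scaleR_2)
  then have "2 * norm p \<le> norm u + norm (adj u)"
    by (metis norm_scaleR norm_triangle_ineq abs_numeral)
  then have "norm p \<le> norm u" by simp
  then show ?thesis unfolding nu[symmetric] by (simp add: power_mono)
qed

section \<open>Neumann series and the square root series\<close>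

lemma neumann_series:
  fixes e :: "'a::{real_normed_algebra_1,banach}"
  assumes "norm e < 1"
  shows "(1 - e) * (\<Sum>n. e ^ n) = 1" "(\<Sum>n. e ^ n) * (1 - e) = 1" "summable (\<lambda>n. e ^ n)"
proof -
  show s: "summable (\<lambda>n. e ^ n)"
    by (rule summable_comparison_test'[OF summable_geometric[of "norm e"]])
      (use assms norm_power_ineq in auto)
  have "(\<Sum>n. e ^ n) = 1 + (\<Sum>n. e ^ Suc n)"
    using suminf_split_head[OF s] by (simp add: algebra_simps)
  moreover have "(\<Sum>n. e ^ Suc n) = e * (\<Sum>n. e ^ n)"
    using suminf_mult[OF s, of e] by simp
  moreover have "(\<Sum>n. e ^ Suc n) = (\<Sum>n. e ^ n) * e"
    using suminf_mult2[OF s, of e] by (simp add: power_commutes)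
  ultimately show "(1 - e) * (\<Sum>n. e ^ n) = 1" "(\<Sum>n. e ^ n) * (1 - e) = 1"
    by (auto simp: algebra_simps)
qed

lemma suminf_in_closed_subspace:
  fixes x :: "nat \<Rightarrow> 'a::real_normed_vector"
  assumes "summable x" "closed T" "subspace T" "\<And>n. x n \<in> T"
  shows "suminf x \<in> T"
proof (rule closed_sequentially[OF assms(2)])
  show "(\<lambda>n. sum x {..<n}) \<longlonglongrightarrow> suminf x" by (rule summable_LIMSEQ[OF assms(1)])
  show "sum x {..<n} \<in> T" for n by (rule subspace_sum) (use assms in auto)
qed

text \<open>The Taylor coefficients of \<open>sqrt (1 - t)\<close> at \<open>0\<close>. All of them except the zeroth are nonpositive,
  which makes the series absolutely convergent on the closed unit ball.\<close>

definition sqrt_coeff :: "nat \<Rightarrow> real" where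
  "sqrt_coeff n = (- 1) ^ n * (1 / 2 gchoose n)"

lemma sqrt_coeff_0 [simp]: "sqrt_coeff 0 = 1"
  by (simp add: sqrt_coeff_def)

lemma sqrt_coeff_Suc_nonpos: "sqrt_coeff (Suc n) \<le> 0"
proof -
  have "sqrt_coeff (Suc n) = pochhammer (- (1 / 2)) (Suc n) / fact (Suc n)"
    by (simp add: sqrt_coeff_def gbinomial_pochhammer power_mult_distrib[symmetric] mult.assoc[symmetric] del: fact_Suc)
  also have "pochhammer (- (1 / 2)) (Suc n) = - (1 / 2) * pochhammer (1 / 2 :: real) n"
    by (simp add: pochhammer_rec)
  also have "- (1 / 2) * pochhammer (1 / 2 :: real) n / fact (Suc n) \<le> 0"
    using pochhammer_pos[of "1/2::real" n] by (simp add: divide_le_0_iff del: fact_Suc)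
  finally show ?thesis .
qed

lemma sum_sqrt_coeff_nonneg: "0 \<le> (\<Sum>k\<le>m. sqrt_coeff k)"
proof -
  have "(\<Sum>k\<le>m. sqrt_coeff k) = (- 1) ^ m * (1 / 2 - 1 gchoose m)"
    unfolding sqrt_coeff_def gbinomial_sum_lower_neg[symmetric] by (simp add: mult.commute)
  also have "\<dots> = pochhammer (1 / 2) m / fact m"
    by (simp add: gbinomial_pochhammer power_mult_distrib[symmetric] mult.assoc[symmetric])
  also have "\<dots> \<ge> 0" by (simp add: pochhammer_nonneg)
  finally show ?thesis .
qed

lemma sum_abs_sqrt_coeff_Suc_le: "(\<Sum>k<m. \<bar>sqrt_coeff (Suc k)\<bar>) \<le> 1"
proof -
  have "(\<Sum>k<m. \<bar>sqrt_coeff (Suc k)\<bar>) = - (\<Sum>k<m. sqrt_coeff (Suc k))"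
    unfolding sum_negf[symmetric] by (intro sum.cong) (simp_all add: sqrt_coeff_Suc_nonpos)
  moreover have "(\<Sum>k\<le>m. sqrt_coeff k) = 1 + (\<Sum>k<m. sqrt_coeff (Suc k))"
    by (subst sum.atMost_shift) simp
  ultimately show ?thesis using sum_sqrt_coeff_nonneg[of m] by simp
qed

lemma summable_abs_sqrt_coeff_Suc: "summable (\<lambda>k. \<bar>sqrt_coeff (Suc k)\<bar>)"
  by (rule summableI_nonneg_bounded[where x = 1]) (simp_all add: sum_abs_sqrt_coeff_Suc_le)

lemma summable_abs_sqrt_coeff: "summable (\<lambda>k. \<bar>sqrt_coeff k\<bar>)"
  using summable_abs_sqrt_coeff_Suc by (simp add: summable_Suc_iff[where f = "\<lambda>k. \<bar>sqrt_coeff k\<bar>"])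

lemma sqrt_coeff_convolution:
  "(\<Sum>i\<le>k. sqrt_coeff i * sqrt_coeff (k - i)) = (if k = 0 then 1 else if k = 1 then - 1 else 0)"
proof -
  have "(\<Sum>i\<le>k. sqrt_coeff i * sqrt_coeff (k - i))
      = (\<Sum>i\<le>k. (- 1) ^ k * ((1 / 2 gchoose i) * (1 / 2 gchoose (k - i))))"
  proof (rule sum.cong)
    fix i assume "i \<in> {..k}"
    then have "(- 1 :: real) ^ k = (- 1) ^ i * (- 1) ^ (k - i)"
      by (simp add: power_add[symmetric])
    then show "sqrt_coeff i * sqrt_coeff (k - i)
        = (- 1) ^ k * ((1 / 2 gchoose i) * (1 / 2 gchoose (k - i)))"
      by (simp add: sqrt_coeff_def)
  qed simp
  also have "\<dots> = (- 1) ^ k * (1 gchoose k)"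
    using gbinomial_Vandermonde[of "1/2::real" "1/2" k]
    by (simp add: sum_distrib_left[symmetric] atLeast0AtMost)
  also have "(1::real) gchoose k = real (1 choose k)"
    using binomial_gbinomial[of 1 k, where ?'a = real] by simp
  finally show ?thesis
    by (cases k) (auto simp: binomial_eq_0)
qed

text \<open>The square root of \<open>1 - y\<close> for \<open>norm y \<le> 1\<close>.\<close>

definition sqrt_one_minus :: "'a::unital_cstar_algebra \<Rightarrow> 'a" where
  "sqrt_one_minus y = (\<Sum>n. sqrt_coeff n *\<^sub>R y ^ n)"

lemma norm_sqrt_term_le:
  assumes "norm (y::'a::unital_cstar_algebra) \<le> 1"
  shows "norm (sqrt_coeff n *\<^sub>R y ^ m) \<le> \<bar>sqrt_coeff n\<bar>"
proof -
  have "norm (y ^ m) \<le> 1"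
    using norm_power_ineq[of y m] power_le_one[of "norm y" m] assms by (meson norm_ge_zero order_trans)
  then show ?thesis using mult_left_le[of "norm (y ^ m)" "\<bar>sqrt_coeff n\<bar>"] by simp
qed

lemma summable_norm_sqrt_series:
  assumes "norm (y::'a::unital_cstar_algebra) \<le> 1"
  shows "summable (\<lambda>n. norm (sqrt_coeff n *\<^sub>R y ^ n))"
  by (rule summable_comparison_test'[OF summable_abs_sqrt_coeff])
    (use norm_sqrt_term_le[OF assms] in simp)

lemmas summable_sqrt_series = summable_norm_cancel[OF summable_norm_sqrt_series]

lemma sqrt_one_minus_square:
  assumes "norm (y::'a::unital_cstar_algebra) \<le> 1"
  shows "sqrt_one_minus y * sqrt_one_minus y = 1 - y"
proof -
  let ?t = "\<lambda>n. sqrt_coeff n *\<^sub>R y ^ n"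
  have "(\<lambda>k. \<Sum>i\<le>k. ?t i * ?t (k - i)) sums (sqrt_one_minus y * sqrt_one_minus y)"
    unfolding sqrt_one_minus_def
    by (intro Cauchy_product_sums summable_norm_sqrt_series assms)
  moreover have "(\<Sum>i\<le>k. ?t i * ?t (k - i)) = (if k = 0 then 1 else if k = 1 then - y else 0)" for k
  proof -
    have "(\<Sum>i\<le>k. ?t i * ?t (k - i)) = (\<Sum>i\<le>k. (sqrt_coeff i * sqrt_coeff (k - i)) *\<^sub>R y ^ k)"
      by (intro sum.cong) (auto simp: power_add[symmetric] mult.commute)
    also have "\<dots> = (\<Sum>i\<le>k. sqrt_coeff i * sqrt_coeff (k - i)) *\<^sub>R y ^ k"
      by (simp add: scaleR_left.sum)
    finally show ?thesis unfolding sqrt_coeff_convolution by simp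
  qed
  moreover have "(\<lambda>k. if k = 0 then 1 else if k = 1 then - y else 0) sums (1 - y)"
    using sums_finite[of "{0,1}" "\<lambda>k::nat. if k = 0 then 1 else if k = 1 then - y else 0"] by simp
  ultimately show ?thesis by (simp add: sums_unique2)
qed

lemma norm_one_minus_sqrt_one_minus_le:
  assumes "norm (y::'a::unital_cstar_algebra) \<le> 1"
  shows "norm (1 - sqrt_one_minus y) \<le> 1"
proof -
  let ?t = "\<lambda>n. sqrt_coeff n *\<^sub>R y ^ n"
  have "1 - sqrt_one_minus y = - (\<Sum>n. ?t (Suc n))"
    using suminf_split_head[OF summable_sqrt_series[OF assms]] by (simp add: sqrt_one_minus_def)
  moreover have "norm (\<Sum>n. ?t (Suc n)) \<le> (\<Sum>n. \<bar>sqrt_coeff (Suc n)\<bar>)"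
    by (rule norm_suminf_le[OF _ summable_abs_sqrt_coeff_Suc]) (rule norm_sqrt_term_le[OF assms])
  moreover have "(\<Sum>n. \<bar>sqrt_coeff (Suc n)\<bar>) \<le> 1"
    by (rule suminf_le_const[OF summable_abs_sqrt_coeff_Suc]) (rule sum_abs_sqrt_coeff_Suc_le)
  ultimately show ?thesis by simp
qed

lemma sqrt_one_minus_in_closed_subspace:
  assumes "norm (y::'a::unital_cstar_algebra) \<le> 1" "closed T" "subspace T" "\<And>n. y ^ n \<in> T"
  shows "sqrt_one_minus y \<in> T"
  unfolding sqrt_one_minus_def
  by (rule suminf_in_closed_subspace[OF summable_sqrt_series[OF assms(1)] assms(2,3)])
    (use assms(3,4) subspace_scale in blast)

lemma adj_sqrt_one_minus:
  assumes "norm (y::'a::unital_cstar_algebra) \<le> 1" "adj y = y"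
  shows "adj (sqrt_one_minus y) = sqrt_one_minus y"
proof -
  have "sqrt_one_minus y \<in> {x. adj x = x}"
  proof (rule sqrt_one_minus_in_closed_subspace[OF assms(1)])
    show "closed {x::'a. adj x = x}"
      by (intro closed_Collect_eq continuous_on_adj continuous_on_id)
  qed (auto simp: subspace_def adj_add adj_scaleR adj_power assms)
  then show ?thesis by simp
qed

lemma sqrt_one_minus_commute:
  assumes "norm (y::'a::unital_cstar_algebra) \<le> 1" "y * z = z * y"
  shows "sqrt_one_minus y * z = z * sqrt_one_minus y"
proof -
  have "sqrt_one_minus y \<in> {x. x * z = z * x}"
  proof (rule sqrt_one_minus_in_closed_subspace[OF assms(1)])
    show "closed {x. x * z = z * x}"
      by (intro closed_Collect_eq continuous_intros)
    show "y ^ n \<in> {x. x * z = z * x}" for n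
      by (simp add: power_commuting_commutes[OF assms(2)])
  qed (auto simp: subspace_def algebra_simps)
  then show ?thesis by simp
qed

lemma continuous_on_sqrt_one_minus:
  "continuous_on (cball 0 1) (sqrt_one_minus :: 'a::unital_cstar_algebra \<Rightarrow> 'a)"
proof (rule uniform_limit_theorem)
  show "uniform_limit (cball 0 1) (\<lambda>N y. \<Sum>n<N. sqrt_coeff n *\<^sub>R y ^ n)
      (sqrt_one_minus :: 'a \<Rightarrow> 'a) sequentially"
    unfolding sqrt_one_minus_def
    by (rule Weierstrass_m_test[OF _ summable_abs_sqrt_coeff]) (use norm_sqrt_term_le in simp)
qed (auto intro!: always_eventually continuous_intros)

section \<open>Squares of self-adjoint elements\<close>

lemma norm_one_minus_square_le:
  assumes "adj z = z" "norm (z::'a::unital_cstar_algebra) \<le> 1"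
  shows "norm (1 - z * z) \<le> 1"
proof -
  have y: "norm (z * z) \<le> 1" "adj (z * z) = z * z"
    using assms by (simp_all add: norm_selfadjoint_square power_le_one adj_mult)
  define w where "w = sqrt_one_minus (z * z)"
  have w: "adj w = w" "w * z = z * w" "w * w = 1 - z * z"
    unfolding w_def
    by (simp_all add: adj_sqrt_one_minus[OF y] sqrt_one_minus_square[OF y(1)]
        sqrt_one_minus_commute[OF y(1)] mult.assoc)
  have "(norm w)\<^sup>2 \<le> 1"
    using norm_square_le_norm_sum_squares[of w z] assms(1) w by simp
  then show ?thesis using norm_selfadjoint_square[OF w(1)] w(3) by simp
qed

lemma norm_one_minus_square_less:
  assumes "adj z = z" "norm (z::'a::unital_cstar_algebra) \<le> 1" "z * y = 1" "y * z = 1"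
  shows "norm (1 - z * z) < 1"
proof -
  have z2: "norm (z * z) \<le> 1" "adj (z * z) = z * z"
    using assms by (simp_all add: norm_selfadjoint_square power_le_one adj_mult)
  have y: "adj y = y" by (rule selfadjoint_inverse[OF assms(1,3,4)])
  have "y \<noteq> 0" using assms(3) by auto
  \<comment> \<open>\<open>z\<^sup>2 - d\<close> is still a square, namely of \<open>z sqrt (1 - d y\<^sup>2)\<close>.\<close>
  define d where "d = 1 / (norm y)\<^sup>2"
  have d: "d > 0" using \<open>y \<noteq> 0\<close> by (simp add: d_def)
  define e where "e = d *\<^sub>R (y * y)"
  have e: "norm e \<le> 1" "adj e = e"
    using \<open>y \<noteq> 0\<close> by (simp_all add: e_def d_def norm_selfadjoint_square[OF y] adj_scaleR adj_mult y)
  have ez: "e * z = z * e"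
    using assms(3,4) by (simp add: e_def) (metis mult.assoc mult.left_neutral mult.right_neutral)
  have zze: "z * z * e = d *\<^sub>R 1"
    using assms(3,4) by (simp add: e_def) (metis mult.assoc mult.right_neutral)
  define q where "q = sqrt_one_minus e"
  have q: "adj q = q" "q * z = z * q" "q * q = 1 - e"
    unfolding q_def
    by (simp_all add: adj_sqrt_one_minus[OF e] sqrt_one_minus_square[OF e(1)]
        sqrt_one_minus_commute[OF e(1)] ez)
  define w where "w = sqrt_one_minus (z * z)"
  have w: "adj w = w" "w * z = z * w" "w * w = 1 - z * z"
    unfolding w_def
    by (simp_all add: adj_sqrt_one_minus[OF z2] sqrt_one_minus_square[OF z2(1)]
        sqrt_one_minus_commute[OF z2(1)] mult.assoc)
  have wq: "w * q = q * w"
    unfolding w_def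
    by (rule sqrt_one_minus_commute[OF z2(1)]) (metis q(2) mult.assoc)
  have "w * w + (z * q) * (z * q) = w * w + z * z * (q * q)"
    by (metis q(2) mult.assoc)
  also have "\<dots> = (1 - d) *\<^sub>R 1"
    unfolding w(3) q(3) using zze by (simp add: algebra_simps)
  finally have sum: "w * w + (z * q) * (z * q) = (1 - d) *\<^sub>R 1" .
  have "adj (z * q) = z * q" by (simp add: adj_mult q assms(1))
  moreover have "w * (z * q) = (z * q) * w" by (metis w(2) wq mult.assoc)
  ultimately have "(norm w)\<^sup>2 \<le> \<bar>1 - d\<bar>"
    using norm_square_le_norm_sum_squares[of w "z * q"] w(1) by (simp add: sum)
  moreover have "1 \<le> norm z * norm y"
    using norm_mult_ineq[of z y] assms(3) by simp
  then have "1 \<le> norm y"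
    using assms(2) mult_right_mono[of "norm z" 1 "norm y"] by simp
  then have "d \<le> 1" by (simp add: d_def divide_le_eq_1)
  ultimately show ?thesis using norm_selfadjoint_square[OF w(1)] w(3) d by simp
qed

section \<open>Closed star-subalgebras and spectral permanence\<close>

text \<open>A closed unital star-subalgebra, given by its carrier set.\<close>

locale cstar_subalgebra =
  fixes S :: "'a::unital_cstar_algebra set"
  assumes subalgebra: "unital_cstar_subalgebra S"
begin

lemma closed_carrier: "closed S"
  and one_in [simp]: "1 \<in> S"
  and add_in [simp]: "x \<in> S \<Longrightarrow> y \<in> S \<Longrightarrow> x + y \<in> S"
  and mult_in [simp]: "x \<in> S \<Longrightarrow> y \<in> S \<Longrightarrow> x * y \<in> S"
  and scaleC_in [simp]: "x \<in> S \<Longrightarrow> c *\<^sub>C x \<in> S"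
  and adj_in [simp]: "x \<in> S \<Longrightarrow> adj x \<in> S"
  using subalgebra unfolding unital_cstar_subalgebra_def by blast+

lemma scaleR_in [simp]: "x \<in> S \<Longrightarrow> r *\<^sub>R x \<in> S"
  using scaleC_in[of x "complex_of_real r"] by simp

lemma zero_in [simp]: "0 \<in> S"
  using scaleR_in[OF one_in, of 0] by simp

lemma minus_in [simp]: "x \<in> S \<Longrightarrow> - x \<in> S"
  using scaleR_in[of x "- 1"] by simp

lemma diff_in [simp]: "x \<in> S \<Longrightarrow> y \<in> S \<Longrightarrow> x - y \<in> S"
  using add_in[of x "- y"] by simp

lemma power_in [simp]: "x \<in> S \<Longrightarrow> x ^ n \<in> S"
  by (induction n) auto

lemma sum_in: "(\<And>i. i \<in> I \<Longrightarrow> x i \<in> S) \<Longrightarrow> sum x I \<in> S"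
  by (induction I rule: infinite_finite_induct) auto

lemma subspace_carrier: "subspace S"
  by (auto simp: subspace_def)

lemma selfadjoint_parts:
  assumes "x \<in> S"
  obtains p q where "p \<in> S" "adj p = p" "q \<in> S" "adj q = q" "x = p + \<i> *\<^sub>C q"
proof
  let ?p = "(1 / 2) *\<^sub>R (x + adj x)" and ?q = "(- \<i> / 2) *\<^sub>C (x - adj x)"
  show "?p \<in> S" "adj ?p = ?p" "?q \<in> S" "adj ?q = ?q"
    using assms
    by (auto simp: adj_scaleR adj_add adj_diff adj_scaleC scaleC_diff_right scaleC_minus_left)
  have "\<i> *\<^sub>C ?q = complex_of_real (1 / 2) *\<^sub>C (x - adj x)" unfolding scaleC_scaleC by simp
  then have "?p + \<i> *\<^sub>C ?q = (1 / 2) *\<^sub>R (x + x)"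
    unfolding scaleC_of_real by (simp add: scaleR_diff_right scaleR_add_right)
  then show "x = ?p + \<i> *\<^sub>C ?q" by (simp flip: scaleR_2)
qed

text \<open>The inverse of \<open>1 - e\<close> is again an element of the subalgebra.\<close>

lemma neumann_in:
  assumes "e \<in> S" "norm e < 1"
  shows "\<exists>v\<in>S. (1 - e) * v = 1 \<and> v * (1 - e) = 1"
proof
  show "(\<Sum>n. e ^ n) \<in> S"
    using neumann_series(3)[OF assms(2)] closed_carrier subspace_carrier assms(1)
    by (intro suminf_in_closed_subspace) auto
qed (use neumann_series[OF assms(2)] in auto)

lemma sqrt_one_minus_in: "y \<in> S \<Longrightarrow> norm y \<le> 1 \<Longrightarrow> sqrt_one_minus y \<in> S"
  by (intro sqrt_one_minus_in_closed_subspace closed_carrier subspace_carrier) auto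

text \<open>Spectral permanence for self-adjoint elements: after rescaling, \<open>1 - z\<^sup>2\<close> has norm less than
  \<open>1\<close>, so the Neumann series inverts \<open>z\<^sup>2\<close> inside the subalgebra.\<close>

lemma inverse_in:
  assumes "z \<in> S" "adj z = z" "z * y = 1" "y * z = 1"
  shows "y \<in> S"
proof -
  define r where "r = norm z"
  have r: "r > 0" using assms(3) by (auto simp: r_def)
  define x where "x = (1 / r) *\<^sub>R z"
  have x: "x \<in> S" "adj x = x" "norm x \<le> 1" "x * (r *\<^sub>R y) = 1" "(r *\<^sub>R y) * x = 1"
    using r assms by (auto simp: x_def adj_scaleR r_def)
  obtain v where v: "v \<in> S" "x * x * v = 1"
    using neumann_in[of "1 - x * x"] norm_one_minus_square_less[OF x(2-5)] x(1) by auto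
  have "r *\<^sub>R y = (r *\<^sub>R y) * x * (x * v)"
    using v(2) by (metis mult.assoc mult.right_neutral)
  then have "y = (1 / r) *\<^sub>R (x * v)"
    using x(5) r by (metis (no_types, lifting) divide_self_if less_irrefl mult.left_neutral
        scaleR_one scaleR_scaleR times_divide_eq_left)
  then show ?thesis using x(1) v(1) by simp
qed

end

section \<open>Maximal ideals and characters of commutative subalgebras\<close>

locale commutative_cstar_subalgebra = cstar_subalgebra +
  assumes comm: "x \<in> S \<Longrightarrow> y \<in> S \<Longrightarrow> x * y = y * x"
begin

text \<open>Ideals of the ring \<open>S\<close>. They are complex subspaces because \<open>S\<close> contains all multiples of \<open>1\<close>.\<close>

definition ideal :: "'a set \<Rightarrow> bool" where
  "ideal J \<longleftrightarrow> J \<subseteq> S \<and> 0 \<in> J \<and> (\<forall>x\<in>J. \<forall>y\<in>J. x + y \<in> J) \<and> (\<forall>x\<in>S. \<forall>y\<in>J. x * y \<in> J)"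

abbreviation proper_ideal :: "'a set \<Rightarrow> bool" where
  "proper_ideal J \<equiv> ideal J \<and> 1 \<notin> J"

text \<open>Maximal among the proper ideals, with respect to inclusion.\<close>

definition maximal_ideal :: "'a set \<Rightarrow> bool" where
  "maximal_ideal M \<longleftrightarrow> proper_ideal M \<and> (\<forall>J. proper_ideal J \<longrightarrow> M \<subseteq> J \<longrightarrow> J = M)"

lemma ideal_adjoin:
  assumes J: "ideal J" and x: "x \<in> S"
  shows "ideal {m + x * s |m s. m \<in> J \<and> s \<in> S}" (is "ideal ?J")
    and "J \<subseteq> {m + x * s |m s. m \<in> J \<and> s \<in> S}"
    and "x \<in> {m + x * s |m s. m \<in> J \<and> s \<in> S}"
proof -
  have mem: "m + x * s \<in> ?J" if "m \<in> J" "s \<in> S" for m s using that by blast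
  have J': "J \<subseteq> S" "0 \<in> J" using J unfolding ideal_def by blast+
  show "J \<subseteq> ?J" using mem[OF _ zero_in] by auto
  then show "x \<in> ?J" using mem[OF J'(2) one_in] by simp
  show "ideal ?J"
    unfolding ideal_def
  proof (intro conjI ballI)
    show "?J \<subseteq> S" using x J' by auto
    show "0 \<in> ?J" using mem[OF J'(2) zero_in] by simp
    fix v assume "v \<in> ?J"
    then obtain m' s' where v: "v = m' + x * s'" "m' \<in> J" "s' \<in> S" by blast
    { fix u assume "u \<in> ?J"
      then obtain m s where u: "u = m + x * s" "m \<in> J" "s \<in> S" by blast
      have "u + v = (m + m') + x * (s + s')" by (simp add: u v algebra_simps)
      moreover have "m + m' \<in> J" using J u v unfolding ideal_def by blast
      ultimately show "u + v \<in> ?J" using mem[of "m + m'" "s + s'"] u(3) v(3) add_in by metis }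
    { fix w assume w: "w \<in> S"
      have "w * v = w * m' + x * (w * s')"
        using comm[OF w x] by (simp add: v distrib_left mult.assoc[symmetric])
      moreover have "w * m' \<in> J" using J w v unfolding ideal_def by blast
      ultimately show "w * v \<in> ?J" using mem[of "w * m'" "w * s'"] w v by simp }
  qed
qed

lemma exists_maximal_ideal:
  assumes "x \<in> S" "\<not> (\<exists>y\<in>S. x * y = 1)"
  shows "\<exists>M. maximal_ideal M \<and> x \<in> M"
proof -
  let ?A = "{J. proper_ideal J \<and> x \<in> J}"
  have "ideal {0}" by (simp add: ideal_def)
  note principal = ideal_adjoin[OF this assms(1)]
  have "{m + x * s |m s. m \<in> {0} \<and> s \<in> S} \<in> ?A"
    using principal(1,3) assms(2) by force
  moreover have "\<Union>\<C> \<in> ?A" if "\<C> \<noteq> {}" "subset.chain ?A \<C>" for \<C>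
  proof -
    have sub: "J \<subseteq> S" and zero: "0 \<in> J" and one: "1 \<notin> J" and x: "x \<in> J"
      and add: "u \<in> J \<Longrightarrow> v \<in> J \<Longrightarrow> u + v \<in> J" and mult: "w \<in> S \<Longrightarrow> v \<in> J \<Longrightarrow> w * v \<in> J"
      if "J \<in> \<C>" for J u v w
      using that \<open>subset.chain ?A \<C>\<close> unfolding subset.chain_def ideal_def by auto
    have chain: "J \<subseteq> K \<or> K \<subseteq> J" if "J \<in> \<C>" "K \<in> \<C>" for J K
      using that \<open>subset.chain ?A \<C>\<close> unfolding subset.chain_def by blast
    obtain J\<^sub>0 where "J\<^sub>0 \<in> \<C>" using \<open>\<C> \<noteq> {}\<close> by blast
    have "ideal (\<Union>\<C>)"
      unfolding ideal_def
    proof (intro conjI ballI)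
      show "\<Union>\<C> \<subseteq> S" using sub by (rule Union_least)
      show "0 \<in> \<Union>\<C>" using \<open>J\<^sub>0 \<in> \<C>\<close> zero by blast
      fix v assume "v \<in> \<Union>\<C>"
      then obtain K where K: "K \<in> \<C>" "v \<in> K" by blast
      { fix u assume "u \<in> \<Union>\<C>"
        then obtain J where J: "J \<in> \<C>" "u \<in> J" by blast
        have "\<exists>L\<in>\<C>. u \<in> L \<and> v \<in> L" using chain[OF J(1) K(1)] J K by blast
        then show "u + v \<in> \<Union>\<C>" using add by blast }
      { fix w assume "w \<in> S"
        then show "w * v \<in> \<Union>\<C>" using mult[OF K(1)] K by blast }
    qed
    moreover have "1 \<notin> \<Union>\<C>" using one by blast
    moreover have "x \<in> \<Union>\<C>" using x \<open>J\<^sub>0 \<in> \<C>\<close> by blast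
    ultimately show ?thesis by simp
  qed
  ultimately obtain M where "M \<in> ?A" "\<forall>X\<in>?A. M \<subseteq> X \<longrightarrow> X = M"
    using subset_Zorn_nonempty[of ?A] by (metis (no_types, lifting) empty_iff)
  then show ?thesis unfolding maximal_ideal_def by blast
qed

context
  fixes M assumes M: "maximal_ideal M"
begin

lemma ideal_subset: "x \<in> M \<Longrightarrow> x \<in> S"
  and ideal_zero: "0 \<in> M"
  and ideal_add: "x \<in> M \<Longrightarrow> y \<in> M \<Longrightarrow> x + y \<in> M"
  and ideal_mult: "s \<in> S \<Longrightarrow> x \<in> M \<Longrightarrow> s * x \<in> M"
  and ideal_one: "1 \<notin> M"
  using M unfolding maximal_ideal_def ideal_def by blast+

lemma ideal_scaleC: "x \<in> M \<Longrightarrow> c *\<^sub>C x \<in> M"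
  using ideal_mult[of "c *\<^sub>C 1" x] by (simp add: mult_scaleC_left)

lemma ideal_diff: "x \<in> M \<Longrightarrow> y \<in> M \<Longrightarrow> x - y \<in> M"
  using ideal_add[of x "- y"] ideal_scaleC[of y "- 1"] by simp

lemma ideal_scaleR: "x \<in> M \<Longrightarrow> r *\<^sub>R x \<in> M"
  using ideal_scaleC[of x "complex_of_real r"] by simp

lemma ideal_comaximal:
  assumes "x \<in> S" "x \<notin> M"
  shows "\<exists>m\<in>M. \<exists>s\<in>S. m + x * s = 1"
proof (rule ccontr)
  assume *: "\<not> ?thesis"
  let ?J = "{m + x * s |m s. m \<in> M \<and> s \<in> S}"
  have "ideal M" using M unfolding maximal_ideal_def by blast
  note J = ideal_adjoin[OF this assms(1)]
  have "1 \<notin> ?J" using * by force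
  then have "?J = M" using M J unfolding maximal_ideal_def by blast
  then show False using assms(2) J(3) by blast
qed

lemma ideal_prime:
  assumes "x \<in> S" "y \<in> S" "x * y \<in> M" "x \<notin> M"
  shows "y \<in> M"
proof -
  obtain m s where ms: "m \<in> M" "s \<in> S" "m + x * s = 1"
    using ideal_comaximal assms by blast
  have "y = y * (m + x * s)" by (simp add: ms)
  also have "\<dots> = y * m + s * (x * y)"
    using assms(1,2) ms(2) comm by (simp add: distrib_left) (metis comm mult.assoc mult_in)
  finally show ?thesis using ms ideal_mult ideal_add assms by metis
qed

lemma small_perturbation_not_in_ideal:
  assumes "w \<in> S" "norm w < c"
  shows "c *\<^sub>R 1 - w \<notin> M"
proof
  assume *: "c *\<^sub>R 1 - w \<in> M"
  have c: "c > 0" using assms(2) by (meson norm_ge_zero order_le_less_trans)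
  obtain v where "v \<in> S" "v * (1 - (1 / c) *\<^sub>R w) = 1"
    using neumann_in[of "(1 / c) *\<^sub>R w"] assms c by auto
  moreover have "(1 / c) *\<^sub>R (c *\<^sub>R 1 - w) = 1 - (1 / c) *\<^sub>R w"
    using c by (simp add: scaleR_diff_right)
  ultimately show False
    using ideal_mult ideal_one ideal_scaleR[OF *, of "1 / c"] by metis
qed

lemma closed_ideal: "closed M"
proof -
  have "closure M \<subseteq> M"
  proof
    fix x assume x: "x \<in> closure M"
    have "x \<in> S"
      using x closure_mono[of M S] ideal_subset closed_carrier by (auto simp: closure_closed)
    show "x \<in> M"
    proof (rule ccontr)
      assume "x \<notin> M"
      then obtain m s where ms: "m \<in> M" "s \<in> S" "m + x * s = 1"
        using ideal_comaximal \<open>x \<in> S\<close> by blast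
      have "1 / (norm s + 1) > 0" by (simp add: add_nonneg_pos)
      then obtain x' where x': "x' \<in> M" "dist x' x < 1 / (norm s + 1)"
        using x unfolding closure_approachable by blast
      have "norm ((x - x') * s) \<le> norm (x - x') * norm s" by (rule norm_mult_ineq)
      also have "\<dots> \<le> norm (x - x') * (norm s + 1)" by (intro mult_left_mono) auto
      also have "\<dots> < 1"
      proof -
        have "norm (x - x') < 1 / (norm s + 1)" using x'(2) by (metis dist_commute dist_norm)
        then show ?thesis by (subst (asm) pos_less_divide_eq) (simp_all add: add_nonneg_pos)
      qed
      finally have "1 *\<^sub>R 1 - (x - x') * s \<notin> M"
        by (intro small_perturbation_not_in_ideal) (use \<open>x \<in> S\<close> ideal_subset[OF x'(1)] ms(2) in simp_all)
      moreover have "1 *\<^sub>R 1 - (x - x') * s = m + s * x'"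
        using ms(3) comm[OF ms(2) ideal_subset[OF x'(1)]] by (simp add: algebra_simps)
      ultimately show False using ideal_add[OF ms(1) ideal_mult[OF ms(2) x'(1)]] by simp
    qed
  qed
  then show ?thesis by (simp add: closure_subset_eq)
qed

text \<open>A substitute for the Gelfand--Mazur theorem: the real value of a self-adjoint element modulo
  \<open>M\<close> is found by a Dedekind cut. Up to a factor, \<open>k s + z s\<close> and \<open>k s - z s\<close> are the positive and
  negative parts of \<open>z s = x - s\<close>. Their product vanishes, so for each \<open>s\<close> one of them lies in
  the prime ideal \<open>M\<close>, and by connectedness of an interval both do for some \<open>s\<close>.\<close>

lemma selfadjoint_scalar_modulo_ideal:
  assumes "x \<in> S" "adj x = x"
  shows "\<exists>r::real. x - r *\<^sub>R 1 \<in> M"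
proof -
  define N R where "N = norm x + 1" and "R = norm x + N"
  have pos: "N > 0" "R > 0" by (simp_all add: N_def R_def add_nonneg_pos)
  define z where "z = (\<lambda>s. x - s *\<^sub>R 1)"
  define y where "y = (\<lambda>s. 1 - ((1 / R) *\<^sub>R z s) * ((1 / R) *\<^sub>R z s))"
  define k where "k = (\<lambda>s. R *\<^sub>R sqrt_one_minus (y s))"
  have zS: "z s \<in> S" and z_adj: "adj (z s) = z s" for s
    using assms by (auto simp: z_def adj_diff adj_scaleR)
  have y_norm: "norm (y s) \<le> 1" if "s \<in> {-N..N}" for s
    unfolding y_def
  proof (rule norm_one_minus_square_le)
    have "norm (z s) \<le> norm x + \<bar>s\<bar>"
      unfolding z_def using norm_triangle_ineq4[of x "s *\<^sub>R 1"] by simp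
    also have "\<dots> \<le> R" using that by (auto simp: R_def)
    finally show "norm ((1 / R) *\<^sub>R z s) \<le> 1" using pos by simp
  qed (simp add: adj_scaleR z_adj)
  have yS: "y s \<in> S" for s unfolding y_def using zS by auto
  have kS: "k s \<in> S" if "s \<in> {-N..N}" for s
    unfolding k_def using sqrt_one_minus_in yS y_norm[OF that] by auto
  have prod0: "(k s + z s) * (k s - z s) = 0" if "s \<in> {-N..N}" for s
  proof -
    have "k s * k s = (R * R) *\<^sub>R (1 - y s)"
      unfolding k_def using sqrt_one_minus_square[OF y_norm[OF that]] by simp
    also have "\<dots> = z s * z s" using pos by (simp add: y_def)
    finally show ?thesis using comm[OF kS[OF that] zS[of s]] by (simp add: algebra_simps)
  qed
  have "continuous_on {-N..N} y" unfolding y_def z_def by (intro continuous_intros)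
  then have "continuous_on {-N..N} (\<lambda>s. sqrt_one_minus (y s))"
    by (rule continuous_on_compose2[OF continuous_on_sqrt_one_minus]) (use y_norm in auto)
  then have cont: "continuous_on {-N..N} (\<lambda>s. k s + z s)" "continuous_on {-N..N} (\<lambda>s. k s - z s)"
    unfolding k_def z_def by (intro continuous_intros; simp)+
  define A B where "A = {-N..N} \<inter> (\<lambda>s. k s + z s) -` M" and "B = {-N..N} \<inter> (\<lambda>s. k s - z s) -` M"
  have closed: "closed A" "closed B"
    unfolding A_def B_def using cont closed_ideal by (auto intro!: continuous_closed_preimage)
  have cover: "{-N..N} \<subseteq> A \<union> B"
  proof
    fix s assume s: "s \<in> {-N..N}"
    then show "s \<in> A \<union> B"
      using ideal_prime[of "k s + z s" "k s - z s"] prod0[OF s] kS[OF s] zS ideal_zero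
      unfolding A_def B_def by auto
  qed
  define h where "h = (\<lambda>s. R *\<^sub>R (1 - sqrt_one_minus (y s)))"
  have h: "norm (h s) \<le> R" "h s \<in> S" "k s = R *\<^sub>R 1 - h s" if "s \<in> {-N..N}" for s
    using norm_one_minus_sqrt_one_minus_le[OF y_norm[OF that]] pos sqrt_one_minus_in[OF yS y_norm[OF that]]
    by (auto simp: h_def k_def scaleR_diff_right mult_left_le simp flip: scaleR_diff_right)
  \<comment> \<open>At the right end the negative part is invertible, at the left end the positive part.\<close>
  have "N \<in> A"
  proof -
    have N: "N \<in> {-N..N}" using pos by simp
    have "norm (h N + x) < R + N"
      using norm_triangle_ineq[of "h N" x] h(1)[OF N] unfolding N_def by linarith
    then have "(R + N) *\<^sub>R 1 - (h N + x) \<notin> M"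
      by (intro small_perturbation_not_in_ideal) (use h[OF N] assms in auto)
    also have "(R + N) *\<^sub>R 1 - (h N + x) = k N - z N"
      unfolding h(3)[OF N] z_def by (simp add: algebra_simps)
    finally have "N \<notin> B" unfolding B_def by simp
    then show ?thesis using cover N by blast
  qed
  moreover have "- N \<in> B"
  proof -
    have N: "- N \<in> {-N..N}" using pos by simp
    have "norm (h (- N) - x) < R + N"
      using norm_triangle_ineq4[of "h (- N)" x] h(1)[OF N] unfolding N_def by linarith
    then have "(R + N) *\<^sub>R 1 - (h (- N) - x) \<notin> M"
      by (intro small_perturbation_not_in_ideal) (use h[OF N] assms in auto)
    also have "(R + N) *\<^sub>R 1 - (h (- N) - x) = k (- N) + z (- N)"
      unfolding h(3)[OF N] z_def by (simp add: algebra_simps)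
    finally have "- N \<notin> A" unfolding A_def by simp
    then show ?thesis using cover N by blast
  qed
  ultimately have "A \<inter> {-N..N} \<noteq> {}" "B \<inter> {-N..N} \<noteq> {}" using pos by auto
  then have "A \<inter> B \<inter> {-N..N} \<noteq> {}"
    using connected_Icc[of "- N" N] closed cover unfolding connected_closed by blast
  then obtain s where "k s + z s \<in> M" "k s - z s \<in> M" unfolding A_def B_def by blast
  then have "(k s + z s) - (k s - z s) \<in> M" by (rule ideal_diff)
  then have "(1 / 2) *\<^sub>R ((k s + z s) - (k s - z s)) \<in> M" by (rule ideal_scaleR)
  also have "(1 / 2) *\<^sub>R ((k s + z s) - (k s - z s)) = z s" by (simp flip: scaleR_2)
  finally show ?thesis unfolding z_def by blast
qed

lemma scalar_modulo_ideal:
  assumes "x \<in> S"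
  shows "\<exists>c. x - c *\<^sub>C 1 \<in> M"
proof -
  obtain p q where pq: "p \<in> S" "adj p = p" "q \<in> S" "adj q = q" "x = p + \<i> *\<^sub>C q"
    using selfadjoint_parts[OF assms] .
  then obtain r s where rs: "p - r *\<^sub>R 1 \<in> M" "q - s *\<^sub>R 1 \<in> M"
    using selfadjoint_scalar_modulo_ideal by meson
  have "x - (of_real r + \<i> * of_real s) *\<^sub>C 1 = (p - r *\<^sub>R 1) + \<i> *\<^sub>C (q - s *\<^sub>R 1)"
    by (simp add: pq(5) scaleC_add_left scaleC_diff_right flip: scaleC_scaleC)
  also have "\<dots> \<in> M" using rs ideal_add ideal_scaleC by blast
  finally show ?thesis by blast
qed

lemma maximal_ideal_character: "\<exists>\<gamma>. character_on S \<gamma> \<and> (\<forall>x\<in>M. \<gamma> x = 0)"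
proof -
  obtain \<gamma> where \<gamma>: "\<And>x. x \<in> S \<Longrightarrow> x - \<gamma> x *\<^sub>C 1 \<in> M"
    using scalar_modulo_ideal by metis
  have unique: "\<gamma> x = c" if "x \<in> S" "x - c *\<^sub>C 1 \<in> M" for x c
  proof (rule ccontr)
    assume ne: "\<gamma> x \<noteq> c"
    have "(x - c *\<^sub>C 1) - (x - \<gamma> x *\<^sub>C 1) \<in> M" by (rule ideal_diff[OF that(2) \<gamma>[OF that(1)]])
    then have "(\<gamma> x - c) *\<^sub>C 1 \<in> M"
      by (simp add: scaleC_diff_left)
    then have "(1 / (\<gamma> x - c)) *\<^sub>C (\<gamma> x - c) *\<^sub>C 1 \<in> M" by (rule ideal_scaleC)
    then show False using ne ideal_one by (simp add: scaleC_scaleC)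
  qed
  have "character_on S \<gamma>"
    unfolding character_on_def
  proof (intro conjI ballI allI)
    fix x y assume xy: "x \<in> S" "y \<in> S"
    have "(x - \<gamma> x *\<^sub>C 1) + (y - \<gamma> y *\<^sub>C 1) \<in> M"
      by (rule ideal_add[OF \<gamma>[OF xy(1)] \<gamma>[OF xy(2)]])
    also have "(x - \<gamma> x *\<^sub>C 1) + (y - \<gamma> y *\<^sub>C 1) = (x + y) - (\<gamma> x + \<gamma> y) *\<^sub>C 1"
      by (simp add: scaleC_add_left)
    finally show "\<gamma> (x + y) = \<gamma> x + \<gamma> y" by (rule unique[OF add_in[OF xy]])
    have "y * (x - \<gamma> x *\<^sub>C 1) + \<gamma> x *\<^sub>C (y - \<gamma> y *\<^sub>C 1) \<in> M"
      by (rule ideal_add[OF ideal_mult[OF xy(2) \<gamma>[OF xy(1)]] ideal_scaleC[OF \<gamma>[OF xy(2)]]])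
    also have "y * (x - \<gamma> x *\<^sub>C 1) + \<gamma> x *\<^sub>C (y - \<gamma> y *\<^sub>C 1) = x * y - (\<gamma> x * \<gamma> y) *\<^sub>C 1"
      unfolding comm[OF xy]
      by (simp add: right_diff_distrib mult_scaleC_right scaleC_diff_right scaleC_scaleC)
    finally show "\<gamma> (x * y) = \<gamma> x * \<gamma> y" by (rule unique[OF mult_in[OF xy]])
  next
    fix c x assume x: "x \<in> S"
    have "c *\<^sub>C (x - \<gamma> x *\<^sub>C 1) \<in> M" by (rule ideal_scaleC[OF \<gamma>[OF x]])
    also have "c *\<^sub>C (x - \<gamma> x *\<^sub>C 1) = c *\<^sub>C x - (c * \<gamma> x) *\<^sub>C 1"
      by (simp add: scaleC_diff_right scaleC_scaleC)
    finally show "\<gamma> (c *\<^sub>C x) = c * \<gamma> x" by (rule unique[OF scaleC_in[OF x]])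
  next
    have "\<gamma> 1 = 1" by (rule unique) (use ideal_zero in auto)
    then show "\<exists>x\<in>S. \<gamma> x \<noteq> 0" by (intro bexI[of _ 1]) simp_all
  qed
  moreover have "\<gamma> x = 0" if "x \<in> M" for x
    by (rule unique) (use that ideal_subset in auto)
  ultimately show ?thesis by blast
qed

end

lemma noninvertible_character:
  assumes "x \<in> S" "\<not> (\<exists>y\<in>S. x * y = 1)"
  shows "\<exists>\<gamma>. character_on S \<gamma> \<and> \<gamma> x = 0"
proof -
  obtain M where M: "maximal_ideal M" "x \<in> M" using exists_maximal_ideal[OF assms] by blast
  show ?thesis using maximal_ideal_character[OF M(1)] M(2) by blast
qed

end

subsection \<open>Properties of characters\<close>

context cstar_subalgebra
begin

context
  fixes \<gamma> assumes \<gamma>: "character_on S \<gamma>"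
begin

lemma character_add: "x \<in> S \<Longrightarrow> y \<in> S \<Longrightarrow> \<gamma> (x + y) = \<gamma> x + \<gamma> y"
  and character_mult: "x \<in> S \<Longrightarrow> y \<in> S \<Longrightarrow> \<gamma> (x * y) = \<gamma> x * \<gamma> y"
  and character_scaleC: "x \<in> S \<Longrightarrow> \<gamma> (c *\<^sub>C x) = c * \<gamma> x"
  using \<gamma> unfolding character_on_def by auto

lemma character_one: "\<gamma> 1 = 1"
proof -
  obtain x where "x \<in> S" "\<gamma> x \<noteq> 0" using \<gamma> unfolding character_on_def by auto
  then show ?thesis using character_mult[of x 1] by simp
qed

lemma character_scaleR: "x \<in> S \<Longrightarrow> \<gamma> (r *\<^sub>R x) = of_real r * \<gamma> x"
  using character_scaleC[of x "of_real r"] by simp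

lemma character_zero: "\<gamma> 0 = 0"
  using character_scaleR[OF one_in, of 0] by simp

lemma character_diff: "x \<in> S \<Longrightarrow> y \<in> S \<Longrightarrow> \<gamma> (x - y) = \<gamma> x - \<gamma> y"
  using character_add[of x "- y"] character_scaleC[of y "- 1"] by simp

lemma character_sum: "(\<And>i. i \<in> I \<Longrightarrow> x i \<in> S) \<Longrightarrow> \<gamma> (sum x I) = (\<Sum>i\<in>I. \<gamma> (x i))"
  by (induction I rule: infinite_finite_induct) (simp_all add: character_zero character_add sum_in)

lemma character_norm_le:
  assumes "x \<in> S"
  shows "cmod (\<gamma> x) \<le> norm x"
proof (rule ccontr)
  assume *: "\<not> ?thesis"
  then have ne: "\<gamma> x \<noteq> 0" by auto
  define e where "e = (1 / \<gamma> x) *\<^sub>C x"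
  have e: "e \<in> S" "norm e < 1" "\<gamma> e = 1"
    using assms * ne by (auto simp: e_def norm_scaleC norm_divide character_scaleC)
  obtain v where "v \<in> S" "(1 - e) * v = 1" using neumann_in[OF e(1,2)] by auto
  then have "\<gamma> (1 - e) * \<gamma> v = 1" using e(1) character_mult[of "1 - e" v] character_one by simp
  then show False using e character_diff[of 1 e] character_one by simp
qed

lemma continuous_on_character: "continuous_on S \<gamma>"
  unfolding continuous_on_iff dist_norm
  using character_norm_le character_diff diff_in by (metis order_le_less_trans)

text \<open>Comparing \<open>\<gamma> (x + i t) = \<gamma> x + i t\<close> with \<open>norm (x + i t)\<close> for all real \<open>t\<close> forces the
  imaginary part of \<open>\<gamma> x\<close> to vanish.\<close>

lemma character_selfadjoint:
  assumes "x \<in> S" "adj x = x"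
  shows "\<gamma> x = of_real (Re (\<gamma> x))"
proof -
  have bound: "(Re (\<gamma> x))\<^sup>2 + (Im (\<gamma> x) + t)\<^sup>2 \<le> (norm x)\<^sup>2 + t\<^sup>2" for t :: real
  proof -
    let ?u = "x + (\<i> * of_real t) *\<^sub>C 1"
    have "\<gamma> ?u = \<gamma> x + \<i> * of_real t"
      using assms(1) by (simp add: character_add character_scaleC character_one)
    then have "(Re (\<gamma> x))\<^sup>2 + (Im (\<gamma> x) + t)\<^sup>2 = (cmod (\<gamma> ?u))\<^sup>2"
      by (simp add: cmod_power2)
    also have "\<dots> \<le> (norm ?u)\<^sup>2"
      using character_norm_le[of ?u] assms(1) by (intro power_mono) auto
    also have "\<dots> = norm (x * x + t\<^sup>2 *\<^sub>R 1)"
    proof -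
      have "adj ?u * ?u = x * x - (\<i> * of_real t * (\<i> * of_real t)) *\<^sub>C 1"
        unfolding adj_add adj_scaleC assms(2)
        by (simp add: scaleC_minus_left left_diff_distrib distrib_left scaleC_scaleC
            scaleC_add_right scaleC_diff_right mult_scaleC_left mult_scaleC_right)
      also have "\<i> * of_real t * (\<i> * of_real t) = complex_of_real (- t\<^sup>2)"
        by (simp add: power2_eq_square complex_eq_iff)
      finally show ?thesis unfolding scaleC_of_real by (simp add: norm_adj_mult_self[symmetric])
    qed
    also have "\<dots> \<le> (norm x)\<^sup>2 + t\<^sup>2"
      using norm_triangle_ineq[of "x * x" "t\<^sup>2 *\<^sub>R 1"] norm_selfadjoint_square[OF assms(2)] by simp
    finally show ?thesis .
  qed
  have "Im (\<gamma> x) = 0"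
  proof (rule ccontr)
    assume ne: "Im (\<gamma> x) \<noteq> 0"
    let ?t = "((norm x)\<^sup>2 + 1) / Im (\<gamma> x)"
    have "(Im (\<gamma> x) + ?t)\<^sup>2 = (Im (\<gamma> x))\<^sup>2 + 2 * ((norm x)\<^sup>2 + 1) + ?t\<^sup>2"
      using ne by (simp add: power2_sum)
    then show False using bound[of ?t] by (smt (verit) zero_le_power2)
  qed
  then show ?thesis by (simp add: complex_eq_iff)
qed

lemma character_adj:
  assumes "x \<in> S"
  shows "\<gamma> (adj x) = cnj (\<gamma> x)"
proof -
  obtain p q where pq: "p \<in> S" "adj p = p" "q \<in> S" "adj q = q" "x = p + \<i> *\<^sub>C q"
    using selfadjoint_parts[OF assms] .
  have "\<gamma> x = \<gamma> p + \<i> * \<gamma> q" "\<gamma> (adj x) = \<gamma> p - \<i> * \<gamma> q"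
    using pq by (simp_all add: adj_add adj_scaleC scaleC_minus_left character_add
        character_diff character_scaleC)
  then show ?thesis
    using character_selfadjoint[OF pq(1,2)] character_selfadjoint[OF pq(3,4)]
    by (metis complex_cnj_add complex_cnj_complex_of_real complex_cnj_i complex_cnj_mult
        diff_conv_add_uminus mult_minus_left)
qed

lemma character_in_spectrum:
  assumes "x \<in> S" "adj x = x"
  shows "\<gamma> x \<in> spectrum x"
proof (rule ccontr)
  assume "\<gamma> x \<notin> spectrum x"
  then obtain y where y: "(x - \<gamma> x *\<^sub>C 1) * y = 1" "y * (x - \<gamma> x *\<^sub>C 1) = 1"
    unfolding spectrum_def by blast
  have "adj (x - \<gamma> x *\<^sub>C 1) = x - \<gamma> x *\<^sub>C 1"
    by (subst (1 2) character_selfadjoint[OF assms]) (simp add: adj_diff adj_scaleR assms(2))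
  moreover have xS: "x - \<gamma> x *\<^sub>C 1 \<in> S" using assms(1) by simp
  ultimately have "y \<in> S" using inverse_in y by blast
  then have "\<gamma> (x - \<gamma> x *\<^sub>C 1) * \<gamma> y = 1"
    using character_mult[OF xS, of y] character_one unfolding y(1) by simp
  then show False using assms(1) by (simp add: character_diff character_scaleC character_one)
qed

lemma character_positive:
  assumes "x \<in> S" "positive_elem x"
  shows "\<exists>r\<ge>0. \<gamma> x = of_real r"
  using character_in_spectrum[OF assms(1)] assms(2)
  unfolding positive_elem_def selfadjoint_def by fastforce

lemma character_restrict:
  assumes "unital_cstar_subalgebra T" "T \<subseteq> S"
  shows "character_on T \<gamma>"
proof -
  have "1 \<in> T" using assms(1) unfolding unital_cstar_subalgebra_def by blast
  then show ?thesis
    unfolding character_on_def using assms(2) character_one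
    by (auto simp: character_add character_mult character_scaleC subset_iff intro!: bexI[of _ 1])
qed

end

end

context commutative_cstar_subalgebra
begin

text \<open>With \<open>r = norm x\<close>, the element \<open>h = r\<^sup>2 - x\<^sup>2\<close> has no inverse: up to the factor \<open>r\<^sup>2\<close> it is
  the square of some \<open>w\<close> in the unit ball, and an inverse would give
  \<open>norm (x\<^sup>2 / r\<^sup>2) = norm (1 - w\<^sup>2) < 1\<close>. A character that vanishes at \<open>h\<close> has modulus \<open>r\<close> at \<open>x\<close>.\<close>

lemma norm_attained_by_character:
  assumes "x \<in> S" "adj x = x"
  shows "\<exists>\<gamma>. character_on S \<gamma> \<and> cmod (\<gamma> x) = norm x"
proof -
  define r where "r = norm x"
  define h where "h = (r * r) *\<^sub>R 1 - x * x"
  have hS: "h \<in> S" using assms by (simp add: h_def)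
  have "\<not> (\<exists>y\<in>S. h * y = 1)"
  proof
    assume "\<exists>y\<in>S. h * y = 1"
    then obtain y where y: "y \<in> S" "h * y = 1" by blast
    have r: "r > 0" using y(2) by (auto simp: h_def r_def)
    define x' where "x' = (1 / r) *\<^sub>R x"
    have x': "x' \<in> S" "adj x' = x'" "norm x' = 1"
      using assms r by (auto simp: x'_def adj_scaleR r_def)
    have xx: "norm (x' * x') = 1" "adj (x' * x') = x' * x'"
      using x' by (simp_all add: norm_selfadjoint_square adj_mult)
    define w where "w = sqrt_one_minus (x' * x')"
    have w: "w \<in> S" "adj w = w" "w * w = 1 - x' * x'"
      unfolding w_def using xx x'
      by (simp_all add: adj_sqrt_one_minus sqrt_one_minus_square sqrt_one_minus_in)
    have nw: "norm w \<le> 1"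
      using norm_one_minus_square_le[of x'] x' norm_selfadjoint_square[OF w(2)] w(3)
      by (simp add: power_le_one_iff)
    have "w * (w * ((r * r) *\<^sub>R y)) = (r * r) *\<^sub>R (1 - x' * x') * y"
      by (simp add: w(3) mult.assoc[symmetric])
    also have "(r * r) *\<^sub>R (1 - x' * x') = h"
      using r by (simp add: x'_def h_def scaleR_diff_right)
    finally have inv: "w * (w * ((r * r) *\<^sub>R y)) = 1" using y(2) by simp
    have "w * ((r * r) *\<^sub>R y) \<in> S" using w(1) y(1) by simp
    then have "(w * ((r * r) *\<^sub>R y)) * w = 1" using inv comm[OF w(1)] by metis
    then have "norm (1 - w * w) < 1" by (rule norm_one_minus_square_less[OF w(2) nw inv])
    then show False using w(3) xx(1) by simp
  qed
  then obtain \<gamma> where \<gamma>: "character_on S \<gamma>" "\<gamma> h = 0" using noninvertible_character[OF hS] by blast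
  have "\<gamma> x * \<gamma> x = complex_of_real (r * r)"
    using \<gamma>(2) assms(1)
    by (simp add: h_def character_diff[OF \<gamma>(1)] character_scaleR[OF \<gamma>(1)] character_mult[OF \<gamma>(1)]
        character_one[OF \<gamma>(1)])
  then have "cmod (\<gamma> x) * cmod (\<gamma> x) = r * r"
    by (metis norm_mult norm_of_real abs_mult_self_eq abs_mult)
  then have "cmod (\<gamma> x) = r"
    by (metis norm_ge_zero power2_eq_iff_nonneg power2_eq_square r_def)
  then show ?thesis using \<gamma>(1) r_def by blast
qed

lemma characters_separate:
  assumes "x \<in> S" "\<And>\<gamma>. character_on S \<gamma> \<Longrightarrow> \<gamma> x = 0"
  shows "x = 0"
proof -
  have "adj x * x \<in> S" "adj (adj x * x) = adj x * x" using assms(1) by (auto simp: adj_mult)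
  then obtain \<gamma> where "character_on S \<gamma>" "cmod (\<gamma> (adj x * x)) = norm (adj x * x)"
    using norm_attained_by_character by blast
  then have "norm (adj x * x) = 0"
    using assms(1) assms(2)[of \<gamma>] by (simp add: character_mult)
  then show ?thesis using norm_adj_mult_self[of x] by simp
qed

text \<open>The spectrum in \<open>positive_elem\<close> is taken in the whole algebra; it is contained in the set
  of values at \<open>x\<close> of the characters of \<open>S\<close>, since invertibility in \<open>S\<close> implies invertibility.\<close>

lemma positive_elemI:
  assumes "x \<in> S" "\<And>\<gamma>. character_on S \<gamma> \<Longrightarrow> \<exists>r\<ge>0. \<gamma> x = of_real r"
  shows "positive_elem x"
  unfolding positive_elem_def selfadjoint_def
proof
  have "adj x - x = 0"
  proof (rule characters_separate)
    fix \<gamma> assume \<gamma>: "character_on S \<gamma>"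
    then show "\<gamma> (adj x - x) = 0"
      using assms(1) assms(2)[OF \<gamma>] by (auto simp: character_diff[OF \<gamma>] character_adj[OF \<gamma>])
  qed (use assms(1) in auto)
  then show "adj x = x" by simp
  show "spectrum x \<subseteq> complex_of_real ` {0..}"
  proof
    fix c assume "c \<in> spectrum x"
    then have "\<not> (\<exists>y\<in>S. (x - c *\<^sub>C 1) * y = 1)"
      using comm[of "x - c *\<^sub>C 1"] assms(1) unfolding spectrum_def by force
    then obtain \<gamma> where \<gamma>: "character_on S \<gamma>" "\<gamma> (x - c *\<^sub>C 1) = 0"
      using noninvertible_character[of "x - c *\<^sub>C 1"] assms(1) by auto
    then have "\<gamma> x = c"
      using assms(1) by (simp add: character_diff character_scaleC character_one)
    then show "c \<in> complex_of_real ` {0..}" using assms(2)[OF \<gamma>(1)] by auto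
  qed
qed

end

section \<open>Generated subalgebras\<close>

lemma cstar_subalgebra_generated: "cstar_subalgebra (cstar_generated G)"
proof
  show "unital_cstar_subalgebra (cstar_generated G)"
    unfolding cstar_generated_def
    by (rule hull_in) (auto simp: unital_cstar_subalgebra_def intro!: closed_Inter)
qed

lemma generators_subset: "G \<subseteq> cstar_generated G"
  unfolding cstar_generated_def by (rule hull_subset)

lemma cstar_generated_minimal:
  "G \<subseteq> T \<Longrightarrow> unital_cstar_subalgebra T \<Longrightarrow> cstar_generated G \<subseteq> T"
  unfolding cstar_generated_def by (rule hull_minimal)

lemma commutant_subalgebra:
  fixes G :: "'a::unital_cstar_algebra set"
  assumes "\<And>g. g \<in> G \<Longrightarrow> adj g \<in> G"
  shows "unital_cstar_subalgebra {x. \<forall>g\<in>G. x * g = g * x}"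
  unfolding unital_cstar_subalgebra_def
proof (intro conjI ballI allI)
  have "{x. \<forall>g\<in>G. x * g = g * x} = (\<Inter>g\<in>G. {x. x * g = g * x})" by blast
  then show "closed {x. \<forall>g\<in>G. x * g = g * x}"
    by (auto intro!: closed_INT closed_Collect_eq continuous_intros)
next
  fix x assume x: "x \<in> {x. \<forall>g\<in>G. x * g = g * x}"
  have "adj x * g = g * adj x" if "g \<in> G" for g
  proof -
    have "adj (x * adj g) = adj (adj g * x)" using x assms[OF that] by simp
    then show ?thesis by (simp add: adj_mult)
  qed
  then show "adj x \<in> {x. \<forall>g\<in>G. x * g = g * x}" by simp
  show "c *\<^sub>C x \<in> {x. \<forall>g\<in>G. x * g = g * x}" for c
    using x by (simp add: mult_scaleC_left mult_scaleC_right)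
  fix y assume y: "y \<in> {x. \<forall>g\<in>G. x * g = g * x}"
  show "x + y \<in> {x. \<forall>g\<in>G. x * g = g * x}"
    using x y by (simp add: distrib_left distrib_right)
  have "x * y * g = g * (x * y)" if "g \<in> G" for g
    using x y that by (metis (mono_tags, lifting) mem_Collect_eq mult.assoc)
  then show "x * y \<in> {x. \<forall>g\<in>G. x * g = g * x}" by simp
qed simp

lemma commutative_generated:
  fixes G :: "'a::unital_cstar_algebra set"
  assumes "\<And>g. g \<in> G \<Longrightarrow> adj g = g" "\<And>g h. g \<in> G \<Longrightarrow> h \<in> G \<Longrightarrow> g * h = h * g"
  shows "commutative_cstar_subalgebra (cstar_generated G)"
proof -
  interpret cstar_subalgebra "cstar_generated G" by (rule cstar_subalgebra_generated)
  have "cstar_generated G \<subseteq> {x. \<forall>g\<in>G. x * g = g * x}"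
    by (rule cstar_generated_minimal[OF _ commutant_subalgebra]) (use assms in auto)
  then have "cstar_generated G \<subseteq> {x. \<forall>g\<in>cstar_generated G. x * g = g * x}"
    by (intro cstar_generated_minimal[OF _ commutant_subalgebra]) (auto simp: subset_iff)
  then show ?thesis by unfold_locales blast
qed

lemma characters_equal_on_generated:
  assumes \<gamma>: "character_on (cstar_generated G) \<gamma>" and \<delta>: "character_on (cstar_generated G) \<delta>"
    and "\<And>g. g \<in> G \<Longrightarrow> \<gamma> g = \<delta> g" "x \<in> cstar_generated G"
  shows "\<gamma> x = \<delta> x"
proof -
  interpret cstar_subalgebra "cstar_generated G" by (rule cstar_subalgebra_generated)
  let ?A = "cstar_generated G"
  have "?A \<subseteq> {x \<in> ?A. \<gamma> x = \<delta> x}"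
  proof (rule cstar_generated_minimal)
    show "G \<subseteq> {x \<in> ?A. \<gamma> x = \<delta> x}" using generators_subset assms(3) by auto
    have "{x \<in> ?A. \<gamma> x = \<delta> x} = ?A \<inter> (\<lambda>x. \<gamma> x - \<delta> x) -` {0}" by auto
    moreover have "closed \<dots>"
      by (intro continuous_closed_preimage continuous_on_diff continuous_on_character \<gamma> \<delta>
          closed_carrier) simp
    ultimately have "closed {x \<in> ?A. \<gamma> x = \<delta> x}" by simp
    then show "unital_cstar_subalgebra {x \<in> ?A. \<gamma> x = \<delta> x}"
      unfolding unital_cstar_subalgebra_def
      by (auto simp: character_one[OF \<gamma>] character_one[OF \<delta>] character_add[OF \<gamma>] character_add[OF \<delta>]
          character_mult[OF \<gamma>] character_mult[OF \<delta>] character_scaleC[OF \<gamma>] character_scaleC[OF \<delta>]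
          character_adj[OF \<gamma>] character_adj[OF \<delta>])
  qed
  then show ?thesis using assms(4) by blast
qed

text \<open>A positive element of norm at most \<open>t\<close> lies in the ball of radius \<open>t\<close> about \<open>t\<close>. This
  form of positivity is stable under sums of noncommuting elements.\<close>

lemma norm_diff_positive_le:
  fixes p :: "'a::unital_cstar_algebra"
  assumes "positive_elem p" "norm p \<le> t"
  shows "norm (t *\<^sub>R 1 - p) \<le> t"
proof -
  have p: "adj p = p" using assms(1) by (simp add: positive_elem_def selfadjoint_def)
  interpret commutative_cstar_subalgebra "cstar_generated {p}"
    by (rule commutative_generated) (use p in auto)
  have pS: "p \<in> cstar_generated {p}" using generators_subset by blast
  have "t *\<^sub>R 1 - p \<in> cstar_generated {p}" "adj (t *\<^sub>R 1 - p) = t *\<^sub>R 1 - p"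
    using pS p by (auto simp: adj_diff adj_scaleR)
  then obtain \<gamma> where \<gamma>: "character_on (cstar_generated {p}) \<gamma>"
      "cmod (\<gamma> (t *\<^sub>R 1 - p)) = norm (t *\<^sub>R 1 - p)"
    using norm_attained_by_character by blast
  obtain r where r: "r \<ge> 0" "\<gamma> p = of_real r" using character_positive[OF \<gamma>(1) pS assms(1)] by blast
  have "r \<le> t" using character_norm_le[OF \<gamma>(1) pS] assms(2) r by simp
  moreover have "\<gamma> (t *\<^sub>R 1 - p) = of_real (t - r)"
    using pS r by (simp add: character_diff[OF \<gamma>(1)] character_scaleR[OF \<gamma>(1)] character_one[OF \<gamma>(1)])
  ultimately show ?thesis using \<gamma>(2) r(1) by (simp del: of_real_diff)
qed

section \<open>Functional calculus for commuting self-adjoint elements\<close>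

text \<open>A finite family of commuting self-adjoint elements, with the C*-algebra \<open>A\<close> that it generates
  and its joint spectrum \<open>K\<close>.\<close>

locale commuting_selfadjoint_family =
  fixes a :: "'n::finite \<Rightarrow> 'a::unital_cstar_algebra"
  assumes adj_family: "adj (a i) = a i"
    and commuting: "a i * a j = a j * a i"
begin

lemma commutative_A: "commutative_cstar_subalgebra (cstar_generated (range a))"
proof (rule commutative_generated)
  show "adj g = g" if "g \<in> range a" for g using that adj_family by blast
  show "g * h = h * g" if "g \<in> range a" "h \<in> range a" for g h using that commuting by blast
qed

sublocale commutative_cstar_subalgebra "cstar_generated (range a)"
  by (rule commutative_A)

abbreviation A :: "'a set" where "A \<equiv> cstar_generated (range a)"
abbreviation K :: "(real^'n) set" where "K \<equiv> joint_spectrum a"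

lemma family_in [simp]: "a i \<in> A"
  by (rule subsetD[OF generators_subset rangeI])

text \<open>The character of the generated algebra that belongs to a point of the joint spectrum.\<close>

definition point_character :: "real^'n \<Rightarrow> 'a \<Rightarrow> complex" where
  "point_character s = (SOME \<gamma>. character_on A \<gamma> \<and> (\<forall>i. \<gamma> (a i) = complex_of_real (s $ i)))"

lemma point_character:
  assumes "s \<in> K"
  shows "character_on A (point_character s)" "point_character s (a i) = complex_of_real (s $ i)"
proof -
  have "\<exists>\<gamma>. character_on A \<gamma> \<and> (\<forall>i. \<gamma> (a i) = complex_of_real (s $ i))"
    using assms unfolding joint_spectrum_def by blast
  from someI_ex[OF this]
  show "character_on A (point_character s)" "point_character s (a i) = complex_of_real (s $ i)"
    unfolding point_character_def by auto
qed

lemma character_eq_point_character: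
  assumes "character_on A \<gamma>" "\<And>i. \<gamma> (a i) = complex_of_real (s $ i)"
  shows "s \<in> K" "x \<in> A \<Longrightarrow> \<gamma> x = point_character s x"
proof -
  show s: "s \<in> K" using assms unfolding joint_spectrum_def by blast
  show "\<gamma> x = point_character s x" if "x \<in> A"
    by (rule characters_equal_on_generated[OF assms(1) point_character(1)[OF s] _ that])
      (use assms(2) point_character(2)[OF s] in auto)
qed

lemma character_has_point:
  assumes "character_on A \<gamma>"
  shows "\<exists>s\<in>K. \<forall>x\<in>A. \<gamma> x = point_character s x"
proof -
  define s where "s = (\<chi> i. Re (\<gamma> (a i)))"
  have "\<gamma> (a i) = complex_of_real (s $ i)" for i
    unfolding s_def using character_selfadjoint[OF assms family_in adj_family] by simp
  then show ?thesis using character_eq_point_character[OF assms] by blast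
qed

lemma joint_spectrum_in_spectra: "s \<in> K \<Longrightarrow> complex_of_real (s $ i) \<in> spectrum (a i)"
  using character_in_spectrum[OF point_character(1) family_in adj_family] point_character(2) by metis

lemma compact_joint_spectrum: "compact K"
proof -
  have "bounded K"
    unfolding bounded_iff
  proof (intro exI ballI)
    fix s assume s: "s \<in> K"
    have "\<bar>s $ i\<bar> \<le> norm (a i)" for i
      using character_norm_le[OF point_character(1)[OF s], of "a i"] point_character(2)[OF s] by simp
    then show "norm s \<le> (\<Sum>i\<in>UNIV. norm (a i))"
      using norm_le_l1_cart[of s] by (meson order_trans sum_mono)
  qed
  moreover have "open (- K)"
    unfolding open_contains_ball
  proof
    fix s assume s: "s \<in> - K"
    \<comment> \<open>At the point \<open>t\<close> of the joint spectrum, \<open>h\<close> takes the value \<open>norm (t - s) ^ 2\<close>. It has no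
      zero, so it is invertible, and its inverse bounds the distance of \<open>s\<close> from \<open>K\<close>.\<close>
    define h where "h = (\<Sum>i\<in>UNIV. (a i - (s $ i) *\<^sub>R 1) * (a i - (s $ i) *\<^sub>R 1))"
    have hA: "h \<in> A" unfolding h_def by (intro sum_in) auto
    have h: "point_character t h = complex_of_real ((norm (t - s))\<^sup>2)" if t: "t \<in> K" for t
    proof -
      note \<gamma> = point_character(1)[OF t]
      have "point_character t h = (\<Sum>i\<in>UNIV. complex_of_real ((t $ i - s $ i) * (t $ i - s $ i)))"
        unfolding h_def
        by (subst character_sum[OF \<gamma>])
          (auto simp: character_mult[OF \<gamma>] character_diff[OF \<gamma>] character_scaleR[OF \<gamma>]
            character_one[OF \<gamma>] point_character(2)[OF t])
      also have "(\<Sum>i\<in>UNIV. complex_of_real ((t $ i - s $ i) * (t $ i - s $ i)))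
          = complex_of_real ((t - s) \<bullet> (t - s))"
        by (simp add: inner_vec_def)
      finally show ?thesis by (simp add: power2_norm_eq_inner)
    qed
    have "\<exists>v\<in>A. h * v = 1"
    proof (rule ccontr)
      assume "\<not> ?thesis"
      then obtain \<gamma> where \<gamma>: "character_on A \<gamma>" "\<gamma> h = 0" using noninvertible_character[OF hA] by blast
      obtain t where "t \<in> K" "\<gamma> h = point_character t h" using character_has_point[OF \<gamma>(1)] hA by blast
      then show False using h[of t] \<gamma>(2) s by simp
    qed
    then obtain v where v: "v \<in> A" "h * v = 1" by blast
    have far: "1 \<le> (norm (t - s))\<^sup>2 * norm v" if t: "t \<in> K" for t
    proof -
      note \<gamma> = point_character(1)[OF t]
      have "cmod (point_character t h * point_character t v) = 1"
        using character_mult[OF \<gamma> hA v(1)] v(2) character_one[OF \<gamma>] by simp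
      then have "1 = (norm (t - s))\<^sup>2 * cmod (point_character t v)"
        unfolding h[OF t] norm_mult norm_of_real by simp
      also have "\<dots> \<le> (norm (t - s))\<^sup>2 * norm v"
        using character_norm_le[OF \<gamma> v(1)] by (rule mult_left_mono) simp
      finally show ?thesis .
    qed
    have nv: "norm v > 0" using v(2) by auto
    have "ball s (1 / sqrt (norm v)) \<subseteq> - K"
    proof
      fix t assume "t \<in> ball s (1 / sqrt (norm v))"
      then have "norm (t - s) < 1 / sqrt (norm v)"
        by (metis dist_commute dist_norm mem_ball)
      then have "(norm (t - s))\<^sup>2 < (1 / sqrt (norm v))\<^sup>2" by (rule power_strict_mono) auto
      then have "(norm (t - s))\<^sup>2 * norm v < 1"
        using nv by (simp add: power_divide pos_less_divide_eq)
      then show "t \<in> - K" using far by force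
    qed
    then show "\<exists>e>0. ball s e \<subseteq> - K" using nv by (intro exI[of _ "1 / sqrt (norm v)"]) simp
  qed
  ultimately show ?thesis by (simp add: compact_eq_bounded_closed closed_def)
qed

lemma norm_attained_on_joint_spectrum:
  assumes "x \<in> A" "adj x = x"
  shows "\<exists>s\<in>K. cmod (point_character s x) = norm x"
  using norm_attained_by_character[OF assms] character_has_point assms(1) by metis

lemma point_characters_separate:
  assumes "x \<in> A" "y \<in> A" "\<And>s. s \<in> K \<Longrightarrow> point_character s x = point_character s y"
  shows "x = y"
proof -
  have "x - y = 0"
  proof (rule characters_separate)
    fix \<gamma> assume \<gamma>: "character_on A \<gamma>"
    obtain s where "s \<in> K" "\<And>x. x \<in> A \<Longrightarrow> \<gamma> x = point_character s x"
      using character_has_point[OF \<gamma>] by blast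
    then have "\<gamma> x = \<gamma> y" using assms by simp
    then show "\<gamma> (x - y) = 0" using assms(1,2) by (simp only: character_diff[OF \<gamma>] diff_self)
  qed (use assms in auto)
  then show ?thesis by simp
qed

lemma continuous_on_gelfand_transform:
  assumes "x \<in> A"
  shows "continuous_on K (\<lambda>s. point_character s x)"
proof -
  let ?T = "{x \<in> A. continuous_on K (\<lambda>s. point_character s x)}"
  have char: "character_on A (point_character s)" if "s \<in> K" for s using point_character(1)[OF that] .
  have "A \<subseteq> ?T"
  proof (rule cstar_generated_minimal)
    have "continuous_on K (\<lambda>s. complex_of_real (s $ i))" for i by (intro continuous_intros)
    then have "continuous_on K (\<lambda>s. point_character s (a i))" for i
      by (subst continuous_on_cong[OF refl point_character(2)])
    then show "range a \<subseteq> ?T" by auto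
    show "unital_cstar_subalgebra ?T"
      unfolding unital_cstar_subalgebra_def
    proof (intro conjI ballI allI)
      show "closed ?T"
        unfolding closed_sequential_limits
      proof (intro allI impI, elim conjE)
        fix f x assume f: "\<forall>n. f n \<in> ?T" "f \<longlonglongrightarrow> x"
        have x: "x \<in> A" using closed_sequentially[OF closed_carrier _ f(2)] f(1) by auto
        have "uniform_limit K (\<lambda>n s. point_character s (f n)) (\<lambda>s. point_character s x) sequentially"
        proof (rule uniform_limitI)
          fix e :: real assume "e > 0"
          then have "eventually (\<lambda>n. dist (f n) x < e) sequentially" using f(2) tendstoD by blast
          then show "\<forall>\<^sub>F n in sequentially. \<forall>s\<in>K. dist (point_character s (f n)) (point_character s x) < e"
          proof eventually_elim
            fix n assume "dist (f n) x < e"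
            moreover have "dist (point_character s (f n)) (point_character s x) \<le> dist (f n) x"
              if "s \<in> K" for s
              using character_norm_le[OF char[OF that], of "f n - x"] f(1) x
              by (simp add: character_diff[OF char[OF that]] dist_norm)
            ultimately show "\<forall>s\<in>K. dist (point_character s (f n)) (point_character s x) < e" by force
          qed
        qed
        then have "continuous_on K (\<lambda>s. point_character s x)"
          by (rule uniform_limit_theorem[rotated]) (use f(1) in auto)
        then show "x \<in> ?T" using x by simp
      qed
      have "continuous_on K (\<lambda>s. 1 :: complex)" by simp
      then have "continuous_on K (\<lambda>s. point_character s 1)"
        by (subst continuous_on_cong[OF refl character_one[OF char]])
      then show "1 \<in> ?T" by simp
    next
      fix x assume x: "x \<in> ?T"
      have "continuous_on K (\<lambda>s. cnj (point_character s x))" using x by (intro continuous_intros) auto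
      then have "continuous_on K (\<lambda>s. point_character s (adj x))"
        using x by (subst continuous_on_cong[OF refl character_adj[OF char]]) auto
      then show "adj x \<in> ?T" using x by auto
      show "c *\<^sub>C x \<in> ?T" for c
      proof -
        have "continuous_on K (\<lambda>s. c * point_character s x)" using x by (intro continuous_intros) auto
        then have "continuous_on K (\<lambda>s. point_character s (c *\<^sub>C x))"
          using x by (subst continuous_on_cong[OF refl character_scaleC[OF char]]) auto
        then show ?thesis using x by auto
      qed
      fix y assume y: "y \<in> ?T"
      have "continuous_on K (\<lambda>s. point_character s x + point_character s y)"
        using x y by (intro continuous_intros) auto
      then have "continuous_on K (\<lambda>s. point_character s (x + y))"
        using x y by (subst continuous_on_cong[OF refl character_add[OF char]]) auto
      then show "x + y \<in> ?T" using x y by auto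
      have "continuous_on K (\<lambda>s. point_character s x * point_character s y)"
        using x y by (intro continuous_intros) auto
      then have "continuous_on K (\<lambda>s. point_character s (x * y))"
        using x y by (subst continuous_on_cong[OF refl character_mult[OF char]]) auto
      then show "x * y \<in> ?T" using x y by auto
    qed
  qed
  then show ?thesis using assms by blast
qed

lemma polynomial_realized:
  assumes "real_polynomial_function p"
  shows "\<exists>x\<in>A. adj x = x \<and> (\<forall>s\<in>K. point_character s x = complex_of_real (p s))"
  using assms
proof (induction p rule: real_polynomial_function.induct)
  case (linear f)
  then have lin: "linear f" by (rule bounded_linear.linear)
  let ?x = "\<Sum>i\<in>UNIV. f (axis i 1) *\<^sub>R a i"
  have "adj ?x = ?x"
    by (simp add: linear_sum[OF bounded_linear.linear[OF bounded_linear_adj]] adj_scaleR adj_family)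
  moreover have "point_character s ?x = complex_of_real (f s)" if s: "s \<in> K" for s
  proof -
    note \<gamma> = point_character(1)[OF s]
    have "f s = f (\<Sum>i\<in>UNIV. (s $ i) *\<^sub>R axis i 1)"
      using basis_expansion[of s] by (simp add: scalar_mult_eq_scaleR)
    also have "\<dots> = (\<Sum>i\<in>UNIV. s $ i * f (axis i 1))"
      by (simp add: linear_sum[OF lin] linear_scale[OF lin])
    finally show ?thesis
      by (subst character_sum[OF \<gamma>])
        (auto simp: character_scaleR[OF \<gamma>] point_character(2)[OF s] mult.commute)
  qed
  ultimately show ?case by (intro bexI[of _ ?x] sum_in) auto
next
  case (const c)
  have "point_character s (c *\<^sub>R 1) = complex_of_real c" if s: "s \<in> K" for s
    using point_character(1)[OF s] by (simp add: character_scaleR character_one)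
  then show ?case by (intro bexI[of _ "c *\<^sub>R 1"]) (auto simp: adj_scaleR)
next
  case (add f g)
  then obtain x y where xy: "x \<in> A" "adj x = x" "\<forall>s\<in>K. point_character s x = complex_of_real (f s)"
    "y \<in> A" "adj y = y" "\<forall>s\<in>K. point_character s y = complex_of_real (g s)" by blast
  have "point_character s (x + y) = complex_of_real (f s + g s)" if s: "s \<in> K" for s
    using point_character(1)[OF s] xy s by (simp add: character_add)
  then show ?case using xy by (intro bexI[of _ "x + y"]) (auto simp: adj_add)
next
  case (mult f g)
  then obtain x y where xy: "x \<in> A" "adj x = x" "\<forall>s\<in>K. point_character s x = complex_of_real (f s)"
    "y \<in> A" "adj y = y" "\<forall>s\<in>K. point_character s y = complex_of_real (g s)" by blast
  have "point_character s (x * y) = complex_of_real (f s * g s)" if s: "s \<in> K" for s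
    using point_character(1)[OF s] xy s by (simp add: character_mult)
  then show ?case using xy comm[of x y] by (intro bexI[of _ "x * y"]) (auto simp: adj_mult)
qed

lemma continuous_real_function_realized:
  fixes g :: "real^'n \<Rightarrow> real"
  assumes "continuous_on K g"
  shows "\<exists>x\<in>A. \<forall>s\<in>K. point_character s x = complex_of_real (g s)"
proof -
  have "\<exists>p. real_polynomial_function p \<and> (\<forall>s\<in>K. \<bar>g s - p s\<bar> < inverse (real (Suc n)))" for n
    using Stone_Weierstrass_real_polynomial_function[OF compact_joint_spectrum assms,
        of "inverse (real (Suc n))"] by (metis inverse_positive_iff_positive of_nat_0_less_iff zero_less_Suc)
  then obtain p where p: "\<And>n. real_polynomial_function (p n)"
      "\<And>n s. s \<in> K \<Longrightarrow> \<bar>g s - p n s\<bar> < inverse (real (Suc n))"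
    by metis
  have "\<exists>x. x \<in> A \<and> adj x = x \<and> (\<forall>s\<in>K. point_character s x = complex_of_real (p n s))" for n
    using polynomial_realized[OF p(1)[of n]] by blast
  then obtain x where x: "\<And>n. x n \<in> A" "\<And>n. adj (x n) = x n"
      "\<And>n s. s \<in> K \<Longrightarrow> point_character s (x n) = complex_of_real (p n s)"
    by metis
  have dist: "dist (x n) (x m) \<le> inverse (real (Suc n)) + inverse (real (Suc m))" for n m
  proof -
    have "x n - x m \<in> A" "adj (x n - x m) = x n - x m" using x(1,2) by (auto simp: adj_diff)
    then obtain s where s: "s \<in> K" "cmod (point_character s (x n - x m)) = norm (x n - x m)"
      using norm_attained_on_joint_spectrum by blast
    have "point_character s (x n - x m) = complex_of_real (p n s - p m s)"
      using x s(1) point_character(1)[OF s(1)] by (simp add: character_diff)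
    then have "dist (x n) (x m) = \<bar>p n s - p m s\<bar>"
      using s(2) by (simp add: dist_norm del: of_real_diff)
    then show ?thesis using p(2)[OF s(1), of n] p(2)[OF s(1), of m] by linarith
  qed
  have "Cauchy x"
  proof (rule metric_CauchyI)
    fix e :: real assume "e > 0"
    then obtain N where N: "inverse (real (Suc N)) < e / 2" using reals_Archimedean[of "e / 2"] by auto
    have "dist (x n) (x m) < e" if "n \<ge> N" "m \<ge> N" for n m
    proof -
      have "inverse (real (Suc n)) \<le> inverse (real (Suc N))" "inverse (real (Suc m)) \<le> inverse (real (Suc N))"
        using that by (auto intro!: le_imp_inverse_le)
      then show ?thesis using dist[of n m] N by linarith
    qed
    then show "\<exists>M. \<forall>m\<ge>M. \<forall>n\<ge>M. dist (x m) (x n) < e" by blast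
  qed
  then obtain y where y: "x \<longlonglongrightarrow> y" using Cauchy_convergent_iff convergent_def by blast
  have yA: "y \<in> A" using closed_sequentially[OF closed_carrier x(1) y] .
  have "point_character s y = complex_of_real (g s)" if s: "s \<in> K" for s
  proof (rule LIMSEQ_unique)
    show "(\<lambda>n. point_character s (x n)) \<longlonglongrightarrow> point_character s y"
      using continuous_on_tendsto_compose[OF continuous_on_character[OF point_character(1)[OF s]] y yA] x(1)
      by simp
    have "\<forall>\<^sub>F n in sequentially. norm (p n s - g s) \<le> inverse (real (Suc n))"
    proof (rule always_eventually, rule allI)
      show "norm (p n s - g s) \<le> inverse (real (Suc n))" for n
        using p(2)[OF s, of n] by (subst norm_minus_commute) (simp only: real_norm_def less_imp_le)
    qed
    from Lim_null_comparison[OF this LIMSEQ_inverse_real_of_nat]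
    have "(\<lambda>n. p n s) \<longlonglongrightarrow> g s" by (rule LIM_zero_cancel)
    then show "(\<lambda>n. point_character s (x n)) \<longlonglongrightarrow> complex_of_real (g s)"
      using tendsto_of_real x(3)[OF s] by simp
  qed
  then show ?thesis using yA by blast
qed

lemma continuous_function_realized:
  fixes g :: "real^'n \<Rightarrow> complex"
  assumes "continuous_on K g"
  shows "\<exists>x\<in>A. \<forall>s\<in>K. point_character s x = g s"
proof -
  have "continuous_on K (\<lambda>s. Re (g s))" "continuous_on K (\<lambda>s. Im (g s))"
    using assms by (auto intro: continuous_intros)
  then obtain x y where xy: "x \<in> A" "\<forall>s\<in>K. point_character s x = complex_of_real (Re (g s))"
      "y \<in> A" "\<forall>s\<in>K. point_character s y = complex_of_real (Im (g s))"
    using continuous_real_function_realized by blast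
  have "point_character s (x + \<i> *\<^sub>C y) = g s" if s: "s \<in> K" for s
    using point_character(1)[OF s] xy s complex_eq[of "g s"]
    by (simp add: character_add character_scaleC)
  then show ?thesis using xy(1,3) by (intro bexI[of _ "x + \<i> *\<^sub>C y"]) simp_all
qed

text \<open>The isomorphism of the generated algebra with the continuous functions on its joint spectrum,
  undefined outside \<open>K\<close> like the elements of its codomain.\<close>

definition gelfand_transform :: "'a \<Rightarrow> real^'n \<Rightarrow> complex" where
  "gelfand_transform x = restrict (\<lambda>s. point_character s x) K"

lemma fun_calc_iso_gelfand_transform: "fun_calc_iso a gelfand_transform"
proof -
  have "bij_betw gelfand_transform A {g \<in> extensional K. continuous_on K g}"
    unfolding bij_betw_def
  proof
    show "inj_on gelfand_transform A"
    proof (rule inj_onI)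
      fix x y assume xy: "x \<in> A" "y \<in> A" "gelfand_transform x = gelfand_transform y"
      have "point_character s x = point_character s y" if "s \<in> K" for s
        using fun_cong[OF xy(3), of s] that by (simp add: gelfand_transform_def)
      then show "x = y" using point_characters_separate xy(1,2) by blast
    qed
    show "gelfand_transform ` A = {g \<in> extensional K. continuous_on K g}"
    proof (intro equalityI subsetI)
      fix g assume "g \<in> gelfand_transform ` A"
      then obtain x where "x \<in> A" "g = gelfand_transform x" by blast
      moreover from this have "continuous_on K g"
        using continuous_on_gelfand_transform[of x]
        by (simp add: gelfand_transform_def cong: continuous_on_cong)
      ultimately show "g \<in> {g \<in> extensional K. continuous_on K g}"
        by (simp add: gelfand_transform_def)
    next
      fix g :: "real^'n \<Rightarrow> complex" assume g: "g \<in> {g \<in> extensional K. continuous_on K g}"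
      then obtain x where x: "x \<in> A" "\<forall>s\<in>K. point_character s x = g s"
        using continuous_function_realized by blast
      have "g = gelfand_transform x"
        by (rule extensionalityI[of _ K]) (use g x in \<open>auto simp: gelfand_transform_def\<close>)
      then show "g \<in> gelfand_transform ` A" using x(1) by blast
    qed
  qed
  then show ?thesis
    unfolding fun_calc_iso_def Let_def gelfand_transform_def
    using character_add[OF point_character(1)] character_mult[OF point_character(1)]
      character_scaleC[OF point_character(1)] character_adj[OF point_character(1)]
      character_one[OF point_character(1)] point_character(2)
    by simp
qed

text \<open>Evaluation of such an isomorphism at a point of \<open>K\<close> is a character with prescribed values on
  the generators; hence the isomorphism is unique on \<open>A\<close>.\<close>

lemma fun_calc_iso_eq_point_character:
  assumes "fun_calc_iso a \<Psi>" "x \<in> A" "s \<in> K"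
  shows "\<Psi> x s = point_character s x"
proof (rule character_eq_point_character(2)[OF _ _ assms(2)])
  show "character_on A (\<lambda>x. \<Psi> x s)"
    unfolding character_on_def
    using assms(1,3) unfolding fun_calc_iso_def Let_def by (auto intro!: bexI[OF _ one_in])
  show "\<Psi> (a i) s = complex_of_real (s $ i)" for i
    using assms(1,3) unfolding fun_calc_iso_def Let_def by auto
qed

lemma fun_calc_point_character:
  assumes "continuous_on K f"
  shows "fun_calc f a \<in> A" "s \<in> K \<Longrightarrow> point_character s (fun_calc f a) = complex_of_real (f s)"
proof -
  obtain b where b: "b \<in> A" "\<forall>s\<in>K. point_character s b = complex_of_real (f s)"
    using continuous_real_function_realized[OF assms] by blast
  have "fun_calc f a = b"
    unfolding fun_calc_def
  proof (rule the_equality)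
    show "b \<in> A \<and> (\<exists>\<Psi>. fun_calc_iso a \<Psi> \<and> (\<forall>s\<in>K. \<Psi> b s = complex_of_real (f s)))"
      using b fun_calc_iso_gelfand_transform fun_calc_iso_eq_point_character by metis
    fix b' assume "b' \<in> A \<and> (\<exists>\<Psi>. fun_calc_iso a \<Psi> \<and> (\<forall>s\<in>K. \<Psi> b' s = complex_of_real (f s)))"
    then show "b' = b"
      using b fun_calc_iso_eq_point_character by (metis point_characters_separate)
  qed
  then show "fun_calc f a \<in> A" "s \<in> K \<Longrightarrow> point_character s (fun_calc f a) = complex_of_real (f s)"
    using b by auto
qed

lemma positive_elem_on_joint_spectrumI:
  assumes "x \<in> A" "\<And>s. s \<in> K \<Longrightarrow> \<exists>r\<ge>0. point_character s x = complex_of_real r"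
  shows "positive_elem x"
  using positive_elemI[OF assms(1)] character_has_point assms by metis

lemma fun_calc_selfadjoint:
  assumes "continuous_on K f"
  shows "adj (fun_calc f a) = fun_calc f a"
proof (rule point_characters_separate)
  show "fun_calc f a \<in> A" by (rule fun_calc_point_character(1)[OF assms])
  then show "adj (fun_calc f a) \<in> A" by simp
  fix s assume s: "s \<in> K"
  show "point_character s (adj (fun_calc f a)) = point_character s (fun_calc f a)"
    unfolding character_adj[OF point_character(1)[OF s] fun_calc_point_character(1)[OF assms]]
      fun_calc_point_character(2)[OF assms s] by simp
qed

lemma positive_diff_affine:
  fixes v :: "real^'n"
  assumes x: "x \<in> A" "\<And>s. s \<in> K \<Longrightarrow> point_character s x = complex_of_real (g s)"
    and le: "\<And>s. s \<in> K \<Longrightarrow> c + v \<bullet> s \<le> g s"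
  shows "positive_elem (x - c *\<^sub>R 1 - (\<Sum>i\<in>UNIV. (v $ i) *\<^sub>R a i))"
proof (rule positive_elem_on_joint_spectrumI)
  have sumA: "(\<Sum>i\<in>UNIV. (v $ i) *\<^sub>R a i) \<in> A" by (intro sum_in) simp
  show "x - c *\<^sub>R 1 - (\<Sum>i\<in>UNIV. (v $ i) *\<^sub>R a i) \<in> A" using x(1) sumA by simp
  fix s assume s: "s \<in> K"
  note \<gamma> = point_character(1)[OF s]
  have "point_character s (\<Sum>i\<in>UNIV. (v $ i) *\<^sub>R a i) = complex_of_real (v \<bullet> s)"
    by (subst character_sum[OF \<gamma>])
      (simp_all add: character_scaleR[OF \<gamma>] point_character(2)[OF s] inner_vec_def)
  then have "point_character s (x - c *\<^sub>R 1 - (\<Sum>i\<in>UNIV. (v $ i) *\<^sub>R a i))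
      = complex_of_real (g s - c - v \<bullet> s)"
    using x(1) sumA x(2)[OF s]
    by (simp add: character_diff[OF \<gamma>] character_scaleR[OF \<gamma>] character_one[OF \<gamma>])
  then show "\<exists>r\<ge>0. point_character s (x - c *\<^sub>R 1 - (\<Sum>i\<in>UNIV. (v $ i) *\<^sub>R a i)) = complex_of_real r"
    using le[OF s] by (intro exI[of _ "g s - c - v \<bullet> s"]) simp
qed

end

section \<open>Supporting affine functions of convex functions\<close>

text \<open>A hyperplane that separates the epigraph from the vertical half-line below \<open>(s, f s)\<close> is not
  vertical because \<open>s\<close> is an interior point of \<open>U\<close>.\<close>

lemma convex_on_subgradient:
  fixes f :: "'a::euclidean_space \<Rightarrow> real"
  assumes "open U" "convex_on U f" "s \<in> U"
  shows "\<exists>v. \<forall>x\<in>U. f s + v \<bullet> (x - s) \<le> f x"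
proof -
  have mem: "(x, y) \<in> epigraph U f \<longleftrightarrow> x \<in> U \<and> f x \<le> y" for x y by (simp add: epigraph_def)
  have "\<exists>a b. a \<noteq> 0 \<and> (\<forall>x\<in>{s} \<times> {..<f s}. a \<bullet> x \<le> b) \<and> (\<forall>x\<in>epigraph U f. b \<le> a \<bullet> x)"
  proof (rule separating_hyperplane_sets)
    show "convex ({s} \<times> {..<f s})" by (intro convex_Times) auto
    show "convex (epigraph U f)" using assms(2) by (simp add: convex_epigraph)
    show "{s} \<times> {..<f s} \<noteq> {}" by (auto intro: lt_ex)
    show "epigraph U f \<noteq> {}" using mem[of s "f s"] assms(3) by auto
    show "{s} \<times> {..<f s} \<inter> epigraph U f = {}" by (auto simp: epigraph_def)
  qed
  then obtain p b where p: "p \<noteq> 0" "\<And>x. x \<in> {s} \<times> {..<f s} \<Longrightarrow> p \<bullet> x \<le> b"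
      "\<And>x. x \<in> epigraph U f \<Longrightarrow> b \<le> p \<bullet> x"
    by blast
  obtain u w where "p = (u, w)" by (cases p)
  then have uw: "(u, w) \<noteq> 0"
      "\<And>y. y < f s \<Longrightarrow> u \<bullet> s + w * y \<le> b"
      "\<And>x z. x \<in> U \<Longrightarrow> f x \<le> z \<Longrightarrow> b \<le> u \<bullet> x + w * z"
    using p(1) p(2)[of "(s, _)"] p(3)[of "(_, _)"] mem by (auto simp: inner_Pair)
  have "w \<ge> 0"
    using uw(2)[of "f s - 1"] uw(3)[OF assms(3), of "f s + 1"] by (simp add: algebra_simps)
  moreover have "w \<noteq> 0"
  proof
    assume w: "w = 0"
    then have u: "u \<noteq> 0" using uw(1) by (simp add: zero_prod_def)
    obtain e where e: "e > 0" "cball s e \<subseteq> U" using assms(1,3) open_contains_cball by blast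
    define x where "x = s - (e / norm u) *\<^sub>R u"
    have "x \<in> U" using e u by (auto simp: x_def subset_iff dist_norm)
    then have "u \<bullet> s \<le> u \<bullet> x"
      using uw(2)[of "f s - 1"] uw(3)[of x "f x"] w by simp
    then have "(e / norm u) * (u \<bullet> u) \<le> 0" by (simp add: x_def inner_diff_right)
    moreover have "(e / norm u) * (u \<bullet> u) > 0" using e(1) u by simp
    ultimately show False by simp
  qed
  ultimately have w: "w > 0" by simp
  have "f s + (- (1 / w) *\<^sub>R u) \<bullet> (x - s) \<le> f x" if "x \<in> U" for x
  proof -
    have "f s \<le> (u \<bullet> (x - s)) / w + f x"
    proof (rule dense_le)
      fix y assume "y < f s"
      then have "u \<bullet> s + w * y \<le> u \<bullet> x + w * f x" using uw(2)[of y] uw(3)[OF that, of "f x"] by simp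
      then show "y \<le> (u \<bullet> (x - s)) / w + f x"
        using w by (simp add: field_simps inner_diff_right)
    qed
    then show ?thesis by (simp add: divide_inverse mult.commute)
  qed
  then show ?thesis by blast
qed

section \<open>Positive linear maps\<close>

locale positive_linear_map =
  fixes \<phi> :: "'a::unital_cstar_algebra \<Rightarrow> 'b::unital_cstar_algebra"
  assumes linear: "Vector_Spaces.linear scaleC scaleC \<phi>"
    and positive: "positive_map \<phi>"
begin

lemma map_add: "\<phi> (x + y) = \<phi> x + \<phi> y"
  using linear unfolding Vector_Spaces.linear_iff by blast

lemma map_scaleR: "\<phi> (r *\<^sub>R x) = r *\<^sub>R \<phi> x"
proof -
  have "\<phi> (complex_of_real r *\<^sub>C x) = complex_of_real r *\<^sub>C \<phi> x"
    using linear unfolding Vector_Spaces.linear_iff by blast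
  then show ?thesis by simp
qed

lemma map_zero: "\<phi> 0 = 0"
  using map_scaleR[of 0 0] by simp

lemma map_diff: "\<phi> (x - y) = \<phi> x - \<phi> y"
  using map_add[of x "- y"] map_scaleR[of "- 1" y] by simp

lemma map_sum: "\<phi> (sum x I) = (\<Sum>i\<in>I. \<phi> (x i))"
  by (induction I rule: infinite_finite_induct) (simp_all add: map_zero map_add)

text \<open>A self-adjoint element is the difference of the positive elements \<open>norm x + x\<close> and \<open>norm x\<close>.\<close>

lemma map_selfadjoint:
  assumes "adj x = x"
  shows "adj (\<phi> x) = \<phi> x"
proof -
  interpret commutative_cstar_subalgebra "cstar_generated {x}"
    by (rule commutative_generated) (use assms in auto)
  have x: "x \<in> cstar_generated {x}" using generators_subset[of "{x}"] by simp
  have "positive_elem (norm x *\<^sub>R (1::'a))"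
  proof (rule positive_elemI)
    show "\<exists>r\<ge>0. \<gamma> (norm x *\<^sub>R (1::'a)) = complex_of_real r" if "character_on (cstar_generated {x}) \<gamma>" for \<gamma>
      using that by (intro exI[of _ "norm x"]) (simp add: character_scaleR character_one)
  qed simp
  moreover have "positive_elem (norm x *\<^sub>R (1::'a) + x)"
  proof (rule positive_elemI)
    fix \<gamma> assume \<gamma>: "character_on (cstar_generated {x}) \<gamma>"
    have "\<gamma> (norm x *\<^sub>R (1::'a) + x) = complex_of_real (norm x + Re (\<gamma> x))"
      using x character_selfadjoint[OF \<gamma> x assms]
      by (simp add: character_add[OF \<gamma>] character_scaleR[OF \<gamma>] character_one[OF \<gamma>])
    moreover have "norm x + Re (\<gamma> x) \<ge> 0"
      using character_norm_le[OF \<gamma> x] abs_Re_le_cmod[of "\<gamma> x"] by linarith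
    ultimately show "\<exists>r\<ge>0. \<gamma> (norm x *\<^sub>R (1::'a) + x) = complex_of_real r" by blast
  qed (simp add: x)
  ultimately have "adj (\<phi> (norm x *\<^sub>R (1::'a))) = \<phi> (norm x *\<^sub>R (1::'a))"
      "adj (\<phi> (norm x *\<^sub>R (1::'a) + x)) = \<phi> (norm x *\<^sub>R (1::'a) + x)"
    using positive unfolding positive_map_def positive_elem_def selfadjoint_def by blast+
  then show ?thesis by (simp add: map_add adj_add)
qed

text \<open>An affine minorant of an element survives \<open>\<phi>\<close> followed by a character. For contractive \<open>\<phi>\<close>
  with \<open>c \<le> 0\<close>, the difference \<open>r\<close> below is \<open>p - c (1 - \<phi> 1)\<close> with \<open>p\<close> positive. Since \<open>\<phi> 1\<close> need
  not commute with the rest, no character is applied to \<open>p\<close>; instead \<open>r\<close> lies in a ball of radius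
  \<open>t\<close> about \<open>t\<close>.\<close>

lemma affine_minorant_character:
  fixes a :: "'n::finite \<Rightarrow> 'a" and v :: "real^'n"
  assumes S: "cstar_subalgebra S" and \<gamma>: "character_on S \<gamma>"
    and mem: "\<And>i. \<phi> (a i) \<in> S" "\<phi> x \<in> S"
    and pos: "positive_elem (x - c *\<^sub>R 1 - (\<Sum>i\<in>UNIV. (v $ i) *\<^sub>R a i))"
    and unital: "\<phi> 1 = 1 \<or> c \<le> 0 \<and> contractive \<phi>"
  shows "c + (\<Sum>i\<in>UNIV. v $ i * Re (\<gamma> (\<phi> (a i)))) \<le> Re (\<gamma> (\<phi> x))"
proof -
  interpret cstar_subalgebra S by (rule S)
  define p where "p = \<phi> (x - c *\<^sub>R 1 - (\<Sum>i\<in>UNIV. (v $ i) *\<^sub>R a i))"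
  define r where "r = \<phi> x - c *\<^sub>R 1 - (\<Sum>i\<in>UNIV. (v $ i) *\<^sub>R \<phi> (a i))"
  have p: "positive_elem p" using positive pos unfolding positive_map_def p_def by blast
  have pr: "p = r + c *\<^sub>R (1 - \<phi> 1)"
    by (simp add: p_def r_def map_diff map_sum map_scaleR scaleR_diff_right)
  have sumS: "(\<Sum>i\<in>UNIV. (v $ i) *\<^sub>R \<phi> (a i)) \<in> S" by (intro sum_in) (simp add: mem)
  have rS: "r \<in> S" using mem(2) sumS by (simp add: r_def)
  have "Re (\<gamma> r) \<ge> 0"
    using unital
  proof
    assume "\<phi> 1 = 1"
    then show ?thesis using character_positive[OF \<gamma> rS] p pr by auto
  next
    assume c: "c \<le> 0 \<and> contractive \<phi>"
    define t where "t = norm p - c"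
    have "t *\<^sub>R 1 - r = (norm p *\<^sub>R 1 - p) + (- c) *\<^sub>R \<phi> 1"
      by (simp add: pr t_def algebra_simps)
    also have "norm \<dots> \<le> norm p + (- c) * norm (\<phi> 1)"
      using norm_triangle_ineq[of "norm p *\<^sub>R 1 - p" "(- c) *\<^sub>R \<phi> 1"] norm_diff_positive_le[OF p order_refl] c
      by simp
    also have "\<dots> \<le> t"
      using c mult_left_mono[of "norm (\<phi> 1)" 1 "- c"] unfolding contractive_def t_def
      by (metis add_left_mono diff_conv_add_uminus mult.right_neutral neg_0_le_iff_le norm_one)
    finally have "cmod (\<gamma> (t *\<^sub>R 1 - r)) \<le> t"
      using character_norm_le[OF \<gamma>, of "t *\<^sub>R 1 - r"] rS by simp
    then have "Re (\<gamma> (t *\<^sub>R 1 - r)) \<le> t" using complex_Re_le_cmod order_trans by blast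
    then show ?thesis
      using rS by (simp add: character_diff[OF \<gamma>] character_scaleR[OF \<gamma>] character_one[OF \<gamma>])
  qed
  moreover have "\<gamma> (\<Sum>i\<in>UNIV. (v $ i) *\<^sub>R \<phi> (a i)) = (\<Sum>i\<in>UNIV. complex_of_real (v $ i) * \<gamma> (\<phi> (a i)))"
    by (subst character_sum[OF \<gamma>]) (simp_all add: mem character_scaleR[OF \<gamma>])
  then have "\<gamma> r = \<gamma> (\<phi> x) - complex_of_real c - (\<Sum>i\<in>UNIV. complex_of_real (v $ i) * \<gamma> (\<phi> (a i)))"
    using mem(2) sumS
    by (simp add: r_def character_diff[OF \<gamma>] character_scaleR[OF \<gamma>] character_one[OF \<gamma>])
  ultimately show ?thesis by simp
qed

text \<open>Strictly separating affine functions show that the joint spectrum of the image lies in the convex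
  hull of the original one, enlarged by \<open>0\<close> if \<open>\<phi>\<close> is not unital.\<close>

lemma joint_spectrum_image_subset:
  fixes a :: "'n::finite \<Rightarrow> 'a"
  assumes a: "commuting_selfadjoint_family a" and \<phi>a: "commuting_selfadjoint_family (\<lambda>i. \<phi> (a i))"
    and U: "convex U" "joint_spectrum a \<subseteq> U"
    and unital: "\<phi> 1 = 1 \<or> 0 \<in> U \<and> contractive \<phi>"
  shows "joint_spectrum (\<lambda>i. \<phi> (a i)) \<subseteq> U"
proof
  interpret F: commuting_selfadjoint_family a by (rule a)
  interpret F': commuting_selfadjoint_family "\<lambda>i. \<phi> (a i)" by (rule \<phi>a)
  fix s assume s: "s \<in> joint_spectrum (\<lambda>i. \<phi> (a i))"
  define Q where "Q = convex hull (joint_spectrum a \<union> (if \<phi> 1 = 1 then {} else {0}))"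
  have "Q \<subseteq> U"
    unfolding Q_def by (rule hull_minimal) (use U unital in auto)
  have "s \<in> Q"
  proof (rule ccontr)
    have "closed Q"
      unfolding Q_def
      by (intro compact_imp_closed compact_convex_hull compact_Un F.compact_joint_spectrum) simp
    moreover assume "s \<notin> Q"
    ultimately obtain v c where vc: "v \<bullet> s < c" "\<And>x. x \<in> Q \<Longrightarrow> c < v \<bullet> x"
      using separating_hyperplane_closed_point[of Q s] convex_convex_hull unfolding Q_def by blast
    have KQ: "t \<in> Q" if "t \<in> joint_spectrum a" for t
      unfolding Q_def using that by (simp add: hull_inc)
    have "positive_elem (0 - c *\<^sub>R 1 - (\<Sum>i\<in>UNIV. ((- v) $ i) *\<^sub>R a i))"
    proof (rule F.positive_diff_affine)
      show "F.point_character t 0 = complex_of_real 0" if "t \<in> joint_spectrum a" for t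
        using F.character_zero[OF F.point_character(1)[OF that]] by simp
      show "c + (- v) \<bullet> t \<le> 0" if "t \<in> joint_spectrum a" for t
        using vc(2)[OF KQ[OF that]] by simp
    qed simp
    moreover have "\<phi> 1 = 1 \<or> c \<le> 0 \<and> contractive \<phi>"
    proof (cases "\<phi> 1 = 1")
      case False
      then have "0 \<in> Q" unfolding Q_def by (simp add: hull_inc)
      then show ?thesis using vc(2)[of 0] unital False by simp
    qed simp
    ultimately have "c + (\<Sum>i\<in>UNIV. (- v) $ i * Re (F'.point_character s (\<phi> (a i))))
        \<le> Re (F'.point_character s (\<phi> 0))"
      by (rule affine_minorant_character[OF F'.cstar_subalgebra_axioms F'.point_character(1)[OF s]
            F'.family_in F'.zero_in[folded map_zero]])
    moreover have "(\<Sum>i\<in>UNIV. (- v) $ i * Re (F'.point_character s (\<phi> (a i)))) = (- v) \<bullet> s"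
      by (simp add: F'.point_character(2)[OF s] inner_vec_def)
    moreover have "F'.point_character s (\<phi> 0) = 0"
      using F'.character_zero[OF F'.point_character(1)[OF s]] by (simp add: map_zero)
    ultimately show False using vc(1) by simp
  qed
  then show "s \<in> U" using \<open>Q \<subseteq> U\<close> by blast
qed

end

section \<open>Jensen's inequality\<close>

theorem theorem4p4:
  fixes \<phi> :: "'a::unital_cstar_algebra \<Rightarrow> 'b::unital_cstar_algebra"
    and U :: "(real^'n::finite) set"
    and f :: "real^'n \<Rightarrow> real"
    and a :: "'n \<Rightarrow> 'a"
  assumes "Vector_Spaces.linear scaleC scaleC \<phi>"
    and "positive_map \<phi>"
    and "open U" and "convex U"
    and "convex_on U f"
    and "\<And>i. selfadjoint (a i)"
    and "\<And>i j. a i * a j = a j * a i"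
    and "{s :: real^'n. \<forall>i. complex_of_real (s $ i) \<in> spectrum (a i)} \<subseteq> U"
    and "\<And>i j. \<phi> (a i) * \<phi> (a j) = \<phi> (a j) * \<phi> (a i)"
    and "\<And>i. \<phi> (a i) * \<phi> (fun_calc f a) = \<phi> (fun_calc f a) * \<phi> (a i)"
  shows "(\<phi> 1 = 1 \<longrightarrow> fun_calc f (\<lambda>i. \<phi> (a i)) \<preceq> \<phi> (fun_calc f a)) \<and>
    (0 \<in> U \<and> f 0 \<le> 0 \<and> contractive \<phi> \<longrightarrow> fun_calc f (\<lambda>i. \<phi> (a i)) \<preceq> \<phi> (fun_calc f a))"
proof -
  interpret positive_linear_map \<phi> by (rule positive_linear_map.intro) (rule assms)+
  have adj_a: "adj (a i) = a i" for i using assms(6) unfolding selfadjoint_def by blast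
  interpret F: commuting_selfadjoint_family a by unfold_locales (rule adj_a assms(7))+
  interpret F': commuting_selfadjoint_family "\<lambda>i. \<phi> (a i)"
    by unfold_locales (rule map_selfadjoint adj_a assms(9))+
  define b where "b = fun_calc f a"
  have KU: "F.K \<subseteq> U" using F.joint_spectrum_in_spectra assms(8) by blast
  have cont_U: "continuous_on U f" by (rule convex_on_continuous[OF assms(3,5)])
  have cont: "continuous_on F.K f" by (rule continuous_on_subset[OF cont_U KU])
  have b: "b \<in> F.A" "adj b = b"
    unfolding b_def by (rule F.fun_calc_point_character(1)[OF cont] F.fun_calc_selfadjoint[OF cont])+
  let ?G = "insert (\<phi> b) (range (\<lambda>i. \<phi> (a i)))"
  let ?C = "cstar_generated ?G"
  interpret C: commutative_cstar_subalgebra ?C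
  proof (rule commutative_generated)
    show "adj g = g" if "g \<in> ?G" for g using that map_selfadjoint b(2) adj_a by blast
    show "g * h = h * g" if "g \<in> ?G" "h \<in> ?G" for g h
      using that assms(9,10) unfolding b_def by auto
  qed
  have gen: "\<phi> b \<in> ?C" "\<phi> (a i) \<in> ?C" for i using generators_subset[of ?G] by auto
  have sub: "F'.A \<subseteq> ?C"
    by (rule cstar_generated_minimal[OF _ C.subalgebra]) (use gen in auto)
  have main: "fun_calc f (\<lambda>i. \<phi> (a i)) \<preceq> \<phi> b"
    if unital: "\<phi> 1 = 1 \<or> 0 \<in> U \<and> f 0 \<le> 0 \<and> contractive \<phi>"
  proof -
    have K'U: "F'.K \<subseteq> U"
      by (rule joint_spectrum_image_subset[OF F.commuting_selfadjoint_family_axioms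
            F'.commuting_selfadjoint_family_axioms assms(4) KU]) (use unital in blast)
    have cont': "continuous_on F'.K f" by (rule continuous_on_subset[OF cont_U K'U])
    have b': "fun_calc f (\<lambda>i. \<phi> (a i)) \<in> ?C" using F'.fun_calc_point_character(1)[OF cont'] sub by blast
    have "positive_elem (\<phi> b - fun_calc f (\<lambda>i. \<phi> (a i)))"
    proof (rule C.positive_elemI)
      show "\<phi> b - fun_calc f (\<lambda>i. \<phi> (a i)) \<in> ?C" using gen(1) b' by simp
      fix \<gamma> assume \<gamma>: "character_on ?C \<gamma>"
      have \<gamma>': "character_on F'.A \<gamma>" by (rule C.character_restrict[OF \<gamma> F'.subalgebra sub])
      define s where "s = (\<chi> i. Re (\<gamma> (\<phi> (a i))))"
      have s: "\<gamma> (\<phi> (a i)) = complex_of_real (s $ i)" for i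
        using C.character_selfadjoint[OF \<gamma> gen(2) map_selfadjoint[OF adj_a]] by (simp add: s_def)
      have sK: "s \<in> F'.K" by (rule F'.character_eq_point_character(1)[OF \<gamma>' s])
      have fval: "\<gamma> (fun_calc f (\<lambda>i. \<phi> (a i))) = complex_of_real (f s)"
        using F'.character_eq_point_character(2)[OF \<gamma>' s F'.fun_calc_point_character(1)[OF cont']]
          F'.fun_calc_point_character(2)[OF cont' sK] by simp
      have "s \<in> U" using sK K'U by blast
      then obtain v where v: "\<And>x. x \<in> U \<Longrightarrow> f s + v \<bullet> (x - s) \<le> f x"
        using convex_on_subgradient[OF assms(3,5)] by blast
      define c where "c = f s - v \<bullet> s"
      have minorant: "c + v \<bullet> x \<le> f x" if "x \<in> U" for x
        using v[OF that] by (simp add: c_def inner_diff_right)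
      have "c + (\<Sum>i\<in>UNIV. v $ i * Re (\<gamma> (\<phi> (a i)))) \<le> Re (\<gamma> (\<phi> b))"
      proof (rule affine_minorant_character[OF C.cstar_subalgebra_axioms \<gamma> gen(2,1)])
        show "positive_elem (b - c *\<^sub>R 1 - (\<Sum>i\<in>UNIV. (v $ i) *\<^sub>R a i))"
          by (rule F.positive_diff_affine[OF b(1), of f])
            (use F.fun_calc_point_character(2)[OF cont] minorant KU in \<open>auto simp: b_def\<close>)
        show "\<phi> 1 = 1 \<or> c \<le> 0 \<and> contractive \<phi>"
          using unital minorant[of 0] by auto
      qed
      then have le: "f s \<le> Re (\<gamma> (\<phi> b))"
        by (simp add: s c_def inner_vec_def)
      have "\<gamma> (\<phi> b - fun_calc f (\<lambda>i. \<phi> (a i))) = complex_of_real (Re (\<gamma> (\<phi> b)) - f s)"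
        unfolding C.character_diff[OF \<gamma> gen(1) b'] fval of_real_diff
        using C.character_selfadjoint[OF \<gamma> gen(1) map_selfadjoint[OF b(2)]] by simp
      then show "\<exists>r\<ge>0. \<gamma> (\<phi> b - fun_calc f (\<lambda>i. \<phi> (a i))) = complex_of_real r"
        using le by (intro exI[of _ "Re (\<gamma> (\<phi> b)) - f s"]) simp
    qed
    then show ?thesis unfolding cstar_le_def .
  qed
  then show ?thesis unfolding b_def by blast
qed

end
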